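(* Let $f:[0,\infty)\to[0,\infty)$ be monotonically increasing (non-decreasing). Let $\{Y_t\}_{t\ge0}$ be the continuous-time, time-inhomogeneous birth-death process on $\mathbb{N}=\{0,1,2,\dots\}$ with $Y_0=1$, birth rate $f(t)$ at time $t$ (in every state, including $0$) and death rate $Y_t$ at time $t$. Let $\mathbf{P}$ be its law and let $V$ be the number of times at which the path of $\{Y_t\}$ jumps from $0$ to $1$. Then $\mathbf{P}(V=\infty)=1$ if and only if $$\int_0^{\infty}e^{-f(t)}f(t)\,dt=\infty.$$ Moreover, if this integral is finite, then $\mathbf{P}(V=\infty)=0$.
   Context: The process $\{Y_t\}$ is defined on the space of paths $\omega:[0,\infty)\to\mathbb{N}$ with $\omega(0)=1$ that are piecewise constant with jumps of size $\pm1$ at a countable, increasing sequence of times. In state $k$ at time $t$ it jumps to $k+1$ at rate $f(t)$ and to $k-1$ at rate $k$. *)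

theory Defs
  imports "HOL-Probability.Probability"
begin

text \<open>Construction of the time-inhomogeneous birth-death process from independent
exponential clocks (competing-clocks construction of the minimal jump process).
From state k at time s the birth clock has hazard f(u) (u > s) and the death
clock has hazard k; the next jump happens at the earlier of the two.\<close>

definition birth_time :: "(real \<Rightarrow> real) \<Rightarrow> real \<Rightarrow> real \<Rightarrow> ereal" where
  "birth_time f s e =
     (if \<exists>t\<ge>s. integral {s..t} f \<ge> e
      then ereal (Inf {t. t \<ge> s \<and> integral {s..t} f \<ge> e}) else \<infinity>)"

definition death_time :: "nat \<Rightarrow> real \<Rightarrow> real \<Rightarrow> ereal" where
  "death_time k s e = (if k = 0 then \<infinity> else ereal (s + e / real k))"

fun bd_step :: "(real \<Rightarrow> real) \<Rightarrow> real \<Rightarrow> real \<Rightarrow> (real \<times> nat) option \<Rightarrow> (real \<times> nat) option" where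
  "bd_step f eb ed None = None"
| "bd_step f eb ed (Some (s, k)) =
     (let b = birth_time f s eb; d = death_time k s ed in
      if b = \<infinity> \<and> d = \<infinity> then None
      else if b < d then Some (real_of_ereal b, k + 1)
      else Some (real_of_ereal d, k - 1))"

text \<open>n-th (jump time, state) of the embedded jump chain, None if fewer than n jumps.\<close>
primrec bd_chain :: "(real \<Rightarrow> real) \<Rightarrow> (nat \<Rightarrow> bool \<Rightarrow> 'a \<Rightarrow> real) \<Rightarrow> nat \<Rightarrow> 'a \<Rightarrow> (real \<times> nat) option" where
  "bd_chain f E 0 \<omega> = Some (0, 1)"
| "bd_chain f E (Suc n) \<omega> = bd_step f (E n True \<omega>) (E n False \<omega>) (bd_chain f E n \<omega>)"

definition up_from_zero :: "(real \<Rightarrow> real) \<Rightarrow> (nat \<Rightarrow> bool \<Rightarrow> 'a \<Rightarrow> real) \<Rightarrow> 'a \<Rightarrow> nat set" where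
  "up_from_zero f E \<omega> =
     {n. \<exists>s s'. bd_chain f E n \<omega> = Some (s, 0) \<and> bd_chain f E (Suc n) \<omega> = Some (s', 1)}"

end

theory Submission
  imports Defs
begin

text \<open>
  Starting from state \<open>k\<close> at time \<open>t\<close>, the state at time \<open>x\<close> is the sum of a Poisson variable with mean
  \<open>lam t x = \<integral>\<^bsub>t\<^esub>\<^bsup>x\<^esup> e\<^bsup>s-x\<^esup> f s ds\<close> and an independent binomial one, so it is \<open>0\<close> with probability
  \<open>h t k x = (1 - e\<^bsup>t-x\<^esup>)\<^bsup>k\<^esup> exp (- lam t x)\<close>. The function \<open>U W (t, k) = \<integral>\<^bsub>W\<^esub> f x h t k x dx\<close>
  is then the expected number of jumps from \<open>0\<close> to \<open>1\<close> at times in \<open>W\<close>. Only the one-step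
  consequence of this is used: \<open>U\<close> is harmonic for the embedded jump chain away from state \<open>0\<close>.

  If the integral converges, then \<open>U UNIV (0, 1)\<close> is finite: writing \<open>w = lam 0\<close>, one has
  \<open>w' = f - w\<close>, and the convexity of \<open>y e\<^bsup>-y\<^esup>\<close> on \<open>[2, \<infinity>)\<close> gives
  \<open>f e\<^bsup>-w\<^esup> \<le> (- (1 + w) e\<^bsup>-w\<^esup>)' + f e\<^bsup>-f\<^esup>\<close> eventually.

  If it diverges, then \<open>U {..R} (0, 0)\<close> tends to infinity with \<open>R\<close>, while
  \<open>U {..R} (r, 0) \<le> 6 + e U {..R} (0, 0)\<close> for all \<open>r \<ge> 0\<close>. Stopping the martingale \<open>U {..R}\<close> at
  the first visit to \<open>0\<close> shows that, from any state, \<open>0\<close> is visited again with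
  probability at least \<open>1/16\<close>. As this bound is uniform, \<open>0\<close> is visited infinitely often.
\<close>

section \<open>Calculus with a monotone rate\<close>

text \<open>If \<open>D\<close> rose, subtracting a small slope would leave a function
  \<open>w\<close> that still rises although its derivative off \<open>S\<close> is
  \<open>- e\<close>. Each of the uncountably many intermediate values of \<open>w\<close> would
  then need its own point of \<open>S\<close>.\<close>

lemma zero_derivative_except_countable_le:
  fixes D :: "real \<Rightarrow> real"
  assumes "a \<le> b" "countable S" "continuous_on {a..b} D"
    and der: "\<And>x. a < x \<Longrightarrow> x < b \<Longrightarrow> x \<notin> S \<Longrightarrow> (D has_real_derivative 0) (at x)"
  shows "D b \<le> D a"
proof (rule ccontr)
  assume "\<not> D b \<le> D a"
  then have lt: "D a < D b" and ab: "a < b"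
    using \<open>a \<le> b\<close> by (auto simp: le_less)
  \<comment> \<open>\<open>c\<close> is half the increase of \<open>D\<close>, so the tilt by
    \<open>e\<close> uses up only half of it.\<close>
  define c where "c = (D b - D a) / 2"
  define e where "e = c / (b - a)"
  define w where "w x = D x - D a - e * (x - a)" for x
  have e: "e > 0" using lt ab by (simp add: e_def c_def)
  have "e * (b - a) = c" using ab by (simp add: e_def)
  then have wb: "w b > 0" using lt by (simp add: w_def c_def)
  have wa: "w a = 0" by (simp add: w_def)
  have wc: "continuous_on {a..b} w"
    unfolding w_def by (intro continuous_intros assms)
  \<comment> \<open>At the last point where \<open>w\<close> takes the value \<open>y\<close> its derivative cannot be \<open>- e\<close>;
    so uncountably many such points lie in \<open>S\<close>.\<close>
  have "\<exists>x\<in>S. w x = y" if y: "0 < y" "y < w b" for y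
  proof -
    define A where "A = {x\<in>{a..b}. w x = y}"
    have "closed A" unfolding A_def
      using continuous_closed_preimage_constant[OF wc] by simp
    moreover have "bounded A"
      by (rule bounded_subset[of "{a..b}"]) (auto simp: A_def)
    ultimately have "compact A" by (simp add: compact_eq_bounded_closed)
    moreover obtain v where "a \<le> v" "v \<le> b" "w v = y"
      using IVT'[of w a y b] y wa ab wc by auto
    then have "A \<noteq> {}" by (auto simp: A_def)
    ultimately obtain x where x: "x \<in> A" "\<And>z. z \<in> A \<Longrightarrow> z \<le> x"
      using compact_attains_sup[of A] by blast
    have xab: "a < x" "x < b"
      using x(1) y wa by (auto simp: A_def order_less_le)
    have above: "w z > y" if z: "x < z" "z \<le> b" for z
    proof (rule ccontr)
      assume "\<not> w z > y"
      then obtain v where "z \<le> v" "v \<le> b" "w v = y"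
        using IVT'[of w z y b] y z xab continuous_on_subset[OF wc, of "{z..b}"] by auto
      then show False using x(2)[of v] z xab by (auto simp: A_def)
    qed
    have "x \<in> S"
    proof (rule ccontr)
      assume "x \<notin> S"
      then have "(D has_real_derivative 0) (at x)" using der xab by blast
      then have "(w has_real_derivative - e) (at x)"
        unfolding w_def by (auto intro!: derivative_eq_intros)
      from DERIV_neg_dec_right[OF this] e obtain d where d: "d > 0" "\<And>h. h > 0 \<Longrightarrow> h < d \<Longrightarrow> w (x + h) < w x"
        by auto
      define h where "h = min (d / 2) (b - x)"
      have "h > 0" "h < d" "x + h \<le> b" using d(1) xab by (auto simp: h_def)
      then show False using d(2)[of h] above[of "x + h"] x(1) by (auto simp: A_def)
    qed
    then show ?thesis using x(1) by (auto simp: A_def)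
  qed
  then have "{0<..<w b} \<subseteq> w ` S" by force
  then have "countable {0<..<w b}"
    using \<open>countable S\<close> countable_subset by blast
  then show False using wb uncountable_open_interval[of 0 "w b"] by simp
qed

lemma zero_derivative_except_countable:
  fixes D :: "real \<Rightarrow> real"
  assumes "a \<le> b" "countable S" "continuous_on {a..b} D"
    and der: "\<And>x. a < x \<Longrightarrow> x < b \<Longrightarrow> x \<notin> S \<Longrightarrow> (D has_real_derivative 0) (at x)"
  shows "D b = D a"
proof (rule antisym)
  show "D b \<le> D a" by (rule zero_derivative_except_countable_le[OF assms])
  have "- D b \<le> - D a"
    by (rule zero_derivative_except_countable_le[where S=S and D = "\<lambda>x. - D x"])
      (use assms in \<open>auto intro!: continuous_intros derivative_eq_intros\<close>)
  then show "D a \<le> D b" by simp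
qed

lemma integrable_mono_times_continuous:
  fixes f p :: "real \<Rightarrow> real"
  assumes "mono f" "continuous_on {a..b} p"
  shows "(\<lambda>x. f x * p x) integrable_on {a..b}"
proof -
  have bm: "bounded (p ` {a..b})"
    using assms(2) compact_continuous_image compact_imp_bounded by blast
  have bf: "bounded (f ` {a..b})"
    unfolding bounded_iff
    by (rule exI[of _ "max \<bar>f a\<bar> \<bar>f b\<bar>"]) (use monoD[OF assms(1)] in \<open>fastforce simp: abs_le_iff max_def\<close>)
  have "p absolutely_integrable_on {a..b}"
    using absolutely_integrable_continuous_real assms(2) by blast
  moreover have "f \<in> borel_measurable (lebesgue_on {a..b})"
    by (intro measurable_restrict_space1 measurable_completion)
      (simp add: borel_measurable_mono[OF assms(1)])
  ultimately have "(\<lambda>x. f x * p x) absolutely_integrable_on {a..b}"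
    using absolutely_integrable_bounded_measurable_product_real[OF _ _ bf] by auto
  then show ?thesis by (simp add: absolutely_integrable_on_def)
qed

text \<open>A monotone function has only countably many discontinuities, so a derivative known at
  the continuity points of \<open>f\<close> suffices. All integrands below have this form with
  continuous \<open>p\<close> and \<open>q\<close>.\<close>

lemma FTC_mono:
  fixes f p q \<Phi> :: "real \<Rightarrow> real"
  assumes "a \<le> b" "mono f" and c: "continuous_on {a..b} p" "continuous_on {a..b} q" "continuous_on {a..b} \<Phi>"
    and der: "\<And>x. isCont f x \<Longrightarrow> a < x \<Longrightarrow> x < b \<Longrightarrow> (\<Phi> has_real_derivative f x * p x + q x) (at x)"
  shows "((\<lambda>x. f x * p x + q x) has_integral \<Phi> b - \<Phi> a) {a..b}"
proof -
  define g where "g x = f x * p x + q x" for x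
  have int: "g integrable_on {a..b}"
    unfolding g_def
    by (intro integrable_add integrable_mono_times_continuous assms integrable_continuous_real)
  define D where "D x = \<Phi> x - integral {a..x} g" for x
  have "D b = D a"
  proof (rule zero_derivative_except_countable[where S="{x. \<not> isCont f x}" and D=D and a=a and b=b])
    show "continuous_on {a..b} D"
      unfolding D_def using indefinite_integral_continuous_1[OF int] c(3)
      by (intro continuous_intros) auto
    fix x assume x: "a < x" "x < b" "x \<notin> {x. \<not> isCont f x}"
    have "isCont p x" "isCont q x"
      using c x by (auto simp: continuous_on_interior)
    then have "isCont g x" unfolding g_def using x by (intro continuous_intros) auto
    then have "continuous (at x within {a..b}) g"
      using continuous_at_imp_continuous_at_within by blast
    then have "((\<lambda>u. integral {a..u} g) has_vector_derivative g x) (at x within ({a..b} - {}))"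
      using x int by (intro integral_has_vector_derivative_continuous_at) auto
    then have "((\<lambda>u. integral {a..u} g) has_real_derivative g x) (at x)"
      using x at_within_Icc_at[of a x b] by (simp add: has_real_derivative_iff_has_vector_derivative)
    moreover have "(\<Phi> has_real_derivative g x) (at x)" using der x by (simp add: g_def)
    ultimately show "(D has_real_derivative 0) (at x)"
      unfolding D_def by (auto intro!: derivative_eq_intros)
  qed (use assms mono_ctble_discont in auto)
  then have "integral {a..b} g = \<Phi> b - \<Phi> a" by (simp add: D_def)
  then show ?thesis using int unfolding g_def by (metis integrable_integral)
qed

text \<open>The integral over a reversed interval is 0, so at most one of the two terms is nonzero
  and the difference is the signed integral from 0 to \<open>x\<close>.\<close>

definition primitive :: "(real \<Rightarrow> real) \<Rightarrow> real \<Rightarrow> real" where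
  "primitive g x = integral {0..x} g - integral {x..0} g"

lemma primitive_diff:
  assumes "\<And>a b. g integrable_on {a..b}" "a \<le> b"
  shows "primitive g b - primitive g a = integral {a..b} g"
proof -
  have c: "integral {x..y} g + integral {y..z} g = integral {x..z} g" if "x \<le> y" "y \<le> z" for x y z
    using Henstock_Kurzweil_Integration.integral_combine[OF that] assms(1) by blast
  have n: "integral {x..y} g = 0" if "x \<ge> y" for x y
    using that by (cases "x = y") auto
  show ?thesis
    using c[of a 0 b] c[of 0 a b] c[of a b 0] n[of 0 a] n[of a 0] n[of 0 b] n[of b 0] assms(2)
    by (cases "a \<le> 0"; cases "b \<le> 0"; simp add: primitive_def)
qed

lemma primitive_has_derivative:
  assumes int: "\<And>a b. g integrable_on {a..b}" and "isCont g x"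
  shows "(primitive g has_real_derivative g x) (at x)"
proof -
  have "((\<lambda>u. integral {x - 1..u} g) has_vector_derivative g x) (at x within ({x - 1..x + 1} - {}))"
    using assms continuous_at_imp_continuous_at_within
    by (intro integral_has_vector_derivative_continuous_at) auto
  then have "((\<lambda>u. integral {x - 1..u} g) has_real_derivative g x) (at x)"
    using at_within_Icc_at[of "x - 1" x "x + 1"] by (simp add: has_real_derivative_iff_has_vector_derivative)
  then have "((\<lambda>u. primitive g (x - 1) + integral {x - 1..u} g) has_real_derivative g x) (at x)"
    by (auto intro!: derivative_eq_intros)
  moreover have "\<forall>\<^sub>F u in nhds x. primitive g (x - 1) + integral {x - 1..u} g = primitive g u"
    using eventually_nhds_in_open[of "{x - 1<..}" x]
    by (auto elim!: eventually_mono simp flip: primitive_diff[OF int])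
  ultimately show ?thesis
    using DERIV_cong_ev[of x x "\<lambda>u. primitive g (x - 1) + integral {x - 1..u} g" "primitive g"] by blast
qed

lemma isCont_primitive:
  assumes int: "\<And>a b. g integrable_on {a..b}"
  shows "isCont (primitive g) x"
proof -
  have "continuous_on {x-1..x+1} (\<lambda>u. primitive g (x - 1) + integral {x - 1..u} g)"
    by (intro continuous_intros indefinite_integral_continuous_1 int)
  also have "?this \<longleftrightarrow> continuous_on {x-1..x+1} (primitive g)"
    by (intro continuous_on_cong) (auto simp flip: primitive_diff[OF int])
  finally show ?thesis by (auto intro!: continuous_on_interior)
qed

lemma nn_FTC_mono:
  fixes f p q \<Phi> :: "real \<Rightarrow> real"
  assumes "a \<le> b" "mono f" and c: "continuous_on {a..b} p" "continuous_on {a..b} q" "continuous_on {a..b} \<Phi>"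
    and der: "\<And>x. isCont f x \<Longrightarrow> a < x \<Longrightarrow> x < b \<Longrightarrow> (\<Phi> has_real_derivative f x * p x + q x) (at x)"
    and nn: "\<And>x. a \<le> x \<Longrightarrow> x \<le> b \<Longrightarrow> 0 \<le> f x * p x + q x"
  shows "(\<integral>\<^sup>+x\<in>{a..b}. ennreal (f x * p x + q x) \<partial>lborel) = ennreal (\<Phi> b - \<Phi> a)"
  using nn_integral_has_integral_lebesgue'[OF _ FTC_mono[OF assms(1-6)]] nn by auto

section \<open>Exponential clocks\<close>

abbreviation Exp1 :: "real measure" where "Exp1 \<equiv> density lborel (exponential_density 1)"

lemma prob_space_Exp1: "prob_space Exp1"
  by (rule prob_space_exponential_density) simp

lemma emeasure_Exp1_greaterThan:
  assumes "0 \<le> a" shows "emeasure Exp1 {a<..} = ennreal (exp (- a))"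
proof -
  interpret prob_space Exp1 by (rule prob_space_Exp1)
  have "distributed Exp1 lborel (\<lambda>x. x) (exponential_density 1)"
    by (auto simp: distributed_def distr_id2)
  from exponential_distributedD_gt[OF this assms]
  show ?thesis by (simp add: emeasure_eq_measure greaterThan_def)
qed

lemma AE_Exp1_pos: "AE a in Exp1. 0 < a"
proof -
  have "AE a in lborel. a \<noteq> (0::real)" by (rule AE_lborel_singleton)
  then show ?thesis by (auto simp: AE_density exponential_density_def)
qed

lemma distributed_exponential_AE_pos:
  assumes "distributed M lborel Y (exponential_density 1)"
  shows "AE \<omega> in M. 0 < Y \<omega>"
proof -
  have [measurable]: "Y \<in> borel_measurable M" using distributed_measurable[OF assms] by simp
  have "distr M borel Y = Exp1"
    using distributed_distr_eq_density[OF assms] by (simp cong: distr_cong)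
  then have "AE x in distr M borel Y. 0 < x" using AE_Exp1_pos by metis
  then show ?thesis by (subst (asm) AE_distr_iff) auto
qed

text \<open>Monotonicity on the whole line avoids sign conditions on times. A rate controlled only
  on nonnegative times enters as \<open>f (max 0 t)\<close>.\<close>

locale birth_rate =
  fixes f :: "real \<Rightarrow> real"
  assumes mono: "mono f" and nonneg: "0 \<le> f x"
begin

definition F :: "real \<Rightarrow> real" where "F = primitive f"
definition L :: "real \<Rightarrow> real" where "L = primitive (\<lambda>s. f s * exp s)"

lemma integrable_times: "continuous_on UNIV p \<Longrightarrow> (\<lambda>x. f x * p x) integrable_on {a..b}"
  by (intro integrable_mono_times_continuous mono) (auto elim: continuous_on_subset)

lemma integrable_f: "f integrable_on {a..b}"
  using integrable_times[of "\<lambda>_. 1"] by simp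

lemma f_measurable [measurable]: "f \<in> borel_measurable borel"
  by (rule borel_measurable_mono[OF mono])

lemma F_diff: "a \<le> b \<Longrightarrow> F b - F a = integral {a..b} f"
  unfolding F_def by (intro primitive_diff integrable_f)

lemma L_diff: "a \<le> b \<Longrightarrow> L b - L a = integral {a..b} (\<lambda>s. f s * exp s)"
  unfolding L_def by (intro primitive_diff integrable_times) (auto intro: continuous_intros)

lemma DERIV_F: "isCont f x \<Longrightarrow> (F has_real_derivative f x) (at x)"
  unfolding F_def by (intro primitive_has_derivative integrable_f)

lemma DERIV_L: "isCont f x \<Longrightarrow> (L has_real_derivative f x * exp x) (at x)"
  unfolding L_def
  by (intro primitive_has_derivative[of "\<lambda>s. f s * exp s"] integrable_times) (auto intro!: continuous_intros)

lemma continuous_F: "continuous_on A F"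
  unfolding F_def by (intro continuous_at_imp_continuous_on ballI isCont_primitive integrable_f)

lemma continuous_L: "continuous_on A L"
  unfolding L_def
  by (intro continuous_at_imp_continuous_on ballI isCont_primitive integrable_times) (auto intro: continuous_intros)

lemmas [continuous_intros] =
  continuous_on_compose2[OF continuous_F[of UNIV] _ subset_UNIV]
  continuous_on_compose2[OF continuous_L[of UNIV] _ subset_UNIV]

lemmas DERIV_FL [derivative_intros] = DERIV_chain2[OF DERIV_F] DERIV_chain2[OF DERIV_L]

lemma F_measurable [measurable]: "F \<in> borel_measurable borel"
  by (intro borel_measurable_continuous_onI continuous_F)

lemma L_measurable [measurable]: "L \<in> borel_measurable borel"
  by (intro borel_measurable_continuous_onI continuous_L)

lemma F_diff_bounds:
  assumes "a \<le> b" shows "f a * (b - a) \<le> F b - F a" "F b - F a \<le> f b * (b - a)"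
proof -
  have e: "((\<lambda>x. c) has_integral c * (b - a)) {a..b}" for c :: real
    using has_integral_const_real[of c a b] assms by (simp add: mult.commute)
  have i: "(f has_integral F b - F a) {a..b}"
    unfolding F_diff[OF assms] by (intro integrable_integral integrable_f)
  show "f a * (b - a) \<le> F b - F a" "F b - F a \<le> f b * (b - a)"
    using has_integral_le[OF e[of "f a"] i] has_integral_le[OF i e[of "f b"]] monoD[OF mono] by auto
qed

lemma F_mono: "a \<le> b \<Longrightarrow> F a \<le> F b"
  using F_diff_bounds(1)[of a b] nonneg[of a] by (smt (verit) mult_nonneg_nonneg)

lemma L_diff_bounds:
  assumes "a \<le> b" shows "f a * (exp b - exp a) \<le> L b - L a" "L b - L a \<le> f b * (exp b - exp a)"
proof -
  have e: "((\<lambda>x. c * exp x) has_integral c * exp b - c * exp a) {a..b}" for c :: real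
    using assms by (intro fundamental_theorem_of_calculus)
      (auto intro!: derivative_eq_intros simp flip: has_real_derivative_iff_has_vector_derivative)
  have i: "((\<lambda>s. f s * exp s) has_integral L b - L a) {a..b}"
    unfolding L_diff[OF assms] by (intro integrable_integral integrable_times continuous_intros)
  show "f a * (exp b - exp a) \<le> L b - L a" "L b - L a \<le> f b * (exp b - exp a)"
    using has_integral_le[OF e[of "f a"] i] has_integral_le[OF i e[of "f b"]] monoD[OF mono]
    by (auto simp: algebra_simps)
qed

definition lam :: "real \<Rightarrow> real \<Rightarrow> real" where "lam t x = exp (- x) * (L x - L t)"

definition h :: "real \<Rightarrow> nat \<Rightarrow> real \<Rightarrow> real" where
  "h t k x = (1 - exp (t - x)) ^ k * exp (- lam t x)"

text \<open>Between \<open>t\<close> and \<open>x\<close> the rate lies between \<open>f t\<close>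
  and \<open>f x\<close>, and the weight \<open>exp (s - x)\<close> has integral
  \<open>1 - exp (t - x)\<close>.\<close>

lemma lam_bounds:
  assumes "t \<le> x" shows "f t * (1 - exp (t - x)) \<le> lam t x" "lam t x \<le> f x * (1 - exp (t - x))"
proof -
  have e: "exp (- x) * (exp x - exp t) = 1 - exp (t - x)"
    by (simp add: algebra_simps flip: exp_add)
  have "exp (- x) * (f t * (exp x - exp t)) \<le> lam t x" "lam t x \<le> exp (- x) * (f x * (exp x - exp t))"
    using L_diff_bounds[OF assms] by (auto simp: lam_def intro!: mult_left_mono)
  then show "f t * (1 - exp (t - x)) \<le> lam t x" "lam t x \<le> f x * (1 - exp (t - x))"
    unfolding e[symmetric] by (simp_all add: mult_ac)
qed

lemma lam_nonneg: "t \<le> x \<Longrightarrow> 0 \<le> lam t x"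
  using lam_bounds(1)[of t x] nonneg[of t] by (smt (verit) exp_le_one_iff mult_nonneg_nonneg)

lemma lam_le: "t \<le> x \<Longrightarrow> lam t x \<le> f x"
  using lam_bounds(2)[of t x] mult_left_mono[OF _ nonneg, of "1 - exp (t - x)" 1 x] by auto

lemma h_nonneg: "t \<le> x \<Longrightarrow> 0 \<le> h t k x" by (simp add: h_def)

lemma lam_measurable [measurable]: "(\<lambda>(t, x). lam t x) \<in> borel_measurable (borel \<Otimes>\<^sub>M borel)"
  unfolding lam_def by measurable

lemma h_measurable [measurable]: "(\<lambda>(t, x). h t k x) \<in> borel_measurable (borel \<Otimes>\<^sub>M borel)"
  unfolding h_def by measurable

lemma DERIV_lam:
  "isCont f x \<Longrightarrow> (lam t has_real_derivative f x - lam t x) (at x)"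
  unfolding lam_def by (auto intro!: derivative_eq_intros simp: algebra_simps simp flip: exp_add)

lemma continuous_lam [continuous_intros]: "continuous_on A (lam t)"
  unfolding lam_def by (intro continuous_intros)

text \<open>The factor \<open>exp (r - x)\<close> stems from differences of neighbouring states:
  \<open>h r k x - h r (Suc k) x = exp (r - x) * h r k x\<close>. For \<open>k = 0\<close> the
  second summand vanishes, whatever \<open>k - 1\<close> is.\<close>

lemma DERIV_h:
  assumes "isCont f r"
  shows "((\<lambda>r. h r k x) has_real_derivative
    exp (r - x) * (f r * h r k x - real k * h r (k - 1) x)) (at r)"
proof -
  have "((\<lambda>r. lam r x) has_real_derivative - (exp (r - x) * f r)) (at r)"
    unfolding lam_def using assms
    by (auto intro!: derivative_eq_intros simp: mult_ac simp flip: exp_add)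
  then show ?thesis
    unfolding h_def by (auto intro!: derivative_eq_intros simp: algebra_simps)
qed

text \<open>The Kolmogorov backward equation for \<open>h\<close>, integrated up to the first jump.\<close>

lemma h_first_jump:
  assumes "s \<le> x"
  shows "(\<integral>\<^sup>+r\<in>{s..x}. ennreal (exp (- (F r - F s) - real k * (r - s)) *
             (f r * h r (Suc k) x + real k * h r (k - 1) x)) \<partial>lborel)
       = ennreal (h s k x - exp (- (F x - F s) - real k * (x - s)) * 0 ^ k)"
proof -
  \<comment> \<open>\<open>G r\<close> is the probability of no jump from state \<open>k\<close>
    between \<open>s\<close> and \<open>r\<close>. As an integrating factor it turns the backward
    equation into an exact derivative.\<close>
  define G where "G r = exp (- (F r - F s) - real k * (r - s))" for r
  have "(\<integral>\<^sup>+r\<in>{s..x}. ennreal (f r * (G r * h r (Suc k) x) + G r * real k * h r (k - 1) x) \<partial>lborel)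
      = ennreal (- (G x * h x k x) - - (G s * h s k x))"
  proof (rule nn_FTC_mono[where \<Phi>="\<lambda>r. - (G r * h r k x)"])
    fix r assume r: "isCont f r" "s < r" "r < x"
    have "(G has_real_derivative - (f r + real k) * G r) (at r)"
      unfolding G_def using r by (auto intro!: derivative_eq_intros simp: algebra_simps)
    moreover have "G r * (f r * h r (Suc k) x) = G r * (f r * h r k x) - G r * (f r * (exp (r - x) * h r k x))"
      by (simp add: h_def algebra_simps)
    moreover have "G r * (real k * h r k x) =
        G r * (real k * h r (k - 1) x) - G r * (real k * (exp (r - x) * h r (k - 1) x))"
      by (cases k) (simp_all add: h_def algebra_simps)
    ultimately show "((\<lambda>r. - (G r * h r k x)) has_real_derivative
        f r * (G r * h r (Suc k) x) + G r * real k * h r (k - 1) x) (at r)"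
      by (auto intro!: derivative_eq_intros DERIV_h r(1) simp: algebra_simps)
  qed (auto simp: assms mono nonneg G_def h_nonneg h_def lam_def intro!: continuous_intros)
  \<comment> \<open>The boundary value \<open>h x k x\<close> equals \<open>0 ^ k\<close>, which is
    1 exactly in state 0.\<close>
  then show ?thesis
    by (simp add: G_def algebra_simps h_def lam_def)
qed

end

section \<open>The birth clock and the one-step kernel\<close>

locale birth_rate_pos = birth_rate +
  assumes pos: "\<exists>t. 0 < f t"
begin

text \<open>To the right of a point \<open>r\<close> with \<open>f r > 0\<close>, monotonicity makes
  \<open>F\<close> grow with slope at least \<open>f r\<close>.\<close>

lemma F_unbounded: "\<exists>t\<ge>s. y \<le> F t"
proof -
  obtain r where r: "0 < f r" using pos by blast
  define t where "t = max s (r + \<bar>y - F r\<bar> / f r)"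
  have "r + 0 \<le> r + \<bar>y - F r\<bar> / f r" using r by (intro add_left_mono) simp
  then have t: "s \<le> t" "r \<le> t" "\<bar>y - F r\<bar> / f r \<le> t - r"
    by (auto simp: t_def)
  then have "\<bar>y - F r\<bar> \<le> f r * (t - r)" using r by (simp add: field_simps)
  then show ?thesis using F_diff_bounds(1)[of r t] t by (intro exI[of _ t]) auto
qed

lemma F_at_top: "filterlim F at_top at_top"
  unfolding filterlim_at_top eventually_at_top_linorder
  using F_unbounded F_mono by (meson order_trans)

text \<open>Real-valued counterpart of \<open>birth_time\<close>: \<open>F\<close> is unbounded
  above, so the set is never empty and no infinite value arises.\<close>

definition bt :: "real \<Rightarrow> real \<Rightarrow> real" where
  "bt s a = Inf {t. s \<le> t \<and> a \<le> F t - F s}"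

text \<open>The set defining \<open>bt\<close> is closed, nonempty, bounded below and closed under
  increasing its elements, hence the half-line from its infimum. Measurability and law of
  \<open>bt\<close> rest on this.\<close>

lemma bt_le_iff: "bt s a \<le> r \<longleftrightarrow> s \<le> r \<and> a \<le> F r - F s"
proof -
  define A where "A = {t. s \<le> t \<and> a \<le> F t - F s}"
  have "closed A" unfolding A_def
    by (intro closed_Collect_conj closed_Collect_le continuous_intros)
  moreover have "A \<noteq> {}" using F_unbounded[of s "a + F s"] by (auto simp: A_def algebra_simps)
  moreover have bdd: "bdd_below A" by (auto simp: A_def)
  ultimately have "Inf A \<in> A" by (intro closed_contains_Inf)
  moreover have "r' \<in> A" if "r \<in> A" "r \<le> r'" for r r'
    using that F_mono[of r r'] by (auto simp: A_def)
  ultimately have "Inf A \<le> r \<longleftrightarrow> r \<in> A"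
    using cInf_lower[OF _ bdd] by blast
  then show ?thesis by (simp add: A_def bt_def)
qed

lemma bt_ge: "s \<le> bt s a" using bt_le_iff[of s a "bt s a"] by simp

lemma bt_measurable [measurable]: "(\<lambda>(s, a). bt s a) \<in> borel_measurable (borel \<Otimes>\<^sub>M borel)"
  unfolding borel_measurable_iff_le by (auto simp: bt_le_iff split_beta')

text \<open>The integral over \<open>{x..x + real n}\<close> is explicit, and divergence of
  \<open>F\<close> removes its upper boundary term in the limit. In particular the birth clock has
  no mass at infinity.\<close>

lemma nn_integral_birth_density:
  assumes "s \<le> x"
  shows "(\<integral>\<^sup>+r\<in>{x..}. ennreal (f r * exp (- (F r - F s))) \<partial>lborel) = ennreal (exp (- (F x - F s)))"
proof -
  define g where "g r = f r * exp (- (F r - F s))" for r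
  have [measurable]: "g \<in> borel_measurable borel" unfolding g_def by measurable
  have fin: "(\<integral>\<^sup>+r\<in>{x..x + real n}. ennreal (g r) \<partial>lborel) =
      ennreal (exp (- (F x - F s)) - exp (- (F (x + real n) - F s)))" for n
  proof -
    have "(\<integral>\<^sup>+r\<in>{x..x + real n}. ennreal (f r * exp (- (F r - F s)) + 0) \<partial>lborel)
        = ennreal (- exp (- (F (x + real n) - F s)) - - exp (- (F x - F s)))"
      by (rule nn_FTC_mono[where \<Phi>="\<lambda>r. - exp (- (F r - F s))"])
        (auto simp: mono nonneg intro!: continuous_intros derivative_eq_intros)
    then show ?thesis by (simp add: g_def)
  qed
  have "(\<lambda>n. \<integral>\<^sup>+r\<in>{x..x + real n}. ennreal (g r) \<partial>lborel) \<longlonglongrightarrow> (\<integral>\<^sup>+r\<in>{x..}. ennreal (g r) \<partial>lborel)"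
  proof (rule nn_integral_LIMSEQ)
    show "incseq (\<lambda>n r. ennreal (g r) * indicator {x..x + real n} r)"
      by (auto simp: incseq_def le_fun_def split: split_indicator)
    fix r
    have "\<forall>\<^sub>F n in sequentially. ennreal (g r) * indicator {x..x + real n} r = ennreal (g r) * indicator {x..} r"
      using eventually_ge_at_top[of "nat \<lceil>r - x\<rceil>"]
      by eventually_elim (auto split: split_indicator simp: nat_le_iff ceiling_le_iff)
    then show "(\<lambda>n. ennreal (g r) * indicator {x..x + real n} r) \<longlonglongrightarrow> ennreal (g r) * indicator {x..} r"
      by (rule tendsto_eventually)
  qed measurable
  moreover have lim: "(\<lambda>n. exp (- (F x - F s)) - exp (- (F (x + real n) - F s))) \<longlonglongrightarrow> exp (- (F x - F s)) - 0"
  proof (intro tendsto_intros)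
    have "filterlim (\<lambda>n. F (x + real n)) at_top sequentially"
      by (intro filterlim_compose[OF F_at_top] filterlim_tendsto_add_at_top[OF tendsto_const]
          filterlim_real_sequentially)
    then have "filterlim (\<lambda>n. - (F (x + real n) - F s)) at_bot sequentially"
      unfolding filterlim_uminus_at_top[symmetric]
      using filterlim_tendsto_add_at_top[of "\<lambda>_. - F s" "- F s"] by fastforce
    then show "(\<lambda>n. exp (- (F (x + real n) - F s))) \<longlonglongrightarrow> 0"
      by (rule filterlim_compose[OF exp_at_bot])
  qed
  ultimately show ?thesis
    using LIMSEQ_unique[OF _ tendsto_ennrealI[OF lim]] unfolding fin unfolding g_def by simp
qed

lemma distr_bt:
  "distr Exp1 borel (bt s) = density lborel (\<lambda>r. ennreal (f r * exp (- (F r - F s))) * indicator {s..} r)"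
proof (rule measure_eqI_lessThan)
  interpret Exp1: prob_space Exp1 by (rule prob_space_Exp1)
  fix x
  have eq: "emeasure (distr Exp1 borel (bt s)) {x<..} = emeasure Exp1 {a. x < bt s a}"
    by (subst emeasure_distr) (auto simp: vimage_def)
  show "emeasure (distr Exp1 borel (bt s)) {x<..} < \<infinity>"
    unfolding eq by (simp add: Exp1.emeasure_eq_measure)
  \<comment> \<open>\<open>max s x\<close> also covers thresholds before the start \<open>s\<close>,
    where the event is certain.\<close>
  have "emeasure Exp1 {a. x < bt s a} = ennreal (exp (- (F (max s x) - F s)))"
  proof (cases "s \<le> x")
    case True
    then have "x < bt s a \<longleftrightarrow> F x - F s < a" for a
      using bt_le_iff[of s a x] by linarith
    then have "{a. x < bt s a} = {F x - F s<..}" by auto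
    then show ?thesis using True F_mono[of s x] by (simp add: emeasure_Exp1_greaterThan max_def)
  next
    case False
    then have "x < bt s a" for a using bt_ge[of s a] by linarith
    then have "{a. x < bt s a} = space Exp1" by auto
    then show ?thesis using False Exp1.emeasure_space_1 by (simp add: max_def)
  qed
  also have "\<dots> = (\<integral>\<^sup>+r\<in>{max s x..}. ennreal (f r * exp (- (F r - F s))) \<partial>lborel)"
    by (rule nn_integral_birth_density[symmetric]) simp
  also have "\<dots> = (\<integral>\<^sup>+r. ennreal (f r * exp (- (F r - F s))) * indicator {s..} r * indicator {x<..} r \<partial>lborel)"
    by (rule nn_integral_cong_AE, use AE_lborel_singleton[of x] in eventually_elim)
      (auto split: split_indicator)
  also have "\<dots> = emeasure (density lborel (\<lambda>r. ennreal (f r * exp (- (F r - F s))) * indicator {s..} r)) {x<..}"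
    by (simp add: emeasure_density)
  finally show "emeasure (distr Exp1 borel (bt s)) {x<..} =
     emeasure (density lborel (\<lambda>r. ennreal (f r * exp (- (F r - F s))) * indicator {s..} r)) {x<..}"
    unfolding eq .
qed auto

lemma nn_integral_bt:
  assumes [measurable]: "g \<in> borel_measurable borel"
  shows "(\<integral>\<^sup>+a. g (bt s a) \<partial>Exp1) = (\<integral>\<^sup>+r\<in>{s..}. ennreal (f r * exp (- (F r - F s))) * g r \<partial>lborel)"
proof -
  have "(\<integral>\<^sup>+a. g (bt s a) \<partial>Exp1) = (\<integral>\<^sup>+r. g r \<partial>distr Exp1 borel (bt s))"
    by (subst nn_integral_distr) auto
  also have "\<dots> = (\<integral>\<^sup>+r\<in>{s..}. ennreal (f r * exp (- (F r - F s))) * g r \<partial>lborel)"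
    unfolding distr_bt by (subst nn_integral_density) (auto simp: mult_ac)
  finally show ?thesis .
qed

lemma emeasure_bt_ge:
  assumes "s \<le> y" shows "emeasure Exp1 {a. y \<le> bt s a} = ennreal (exp (- (F y - F s)))"
proof -
  have "emeasure Exp1 {a. y \<le> bt s a} = (\<integral>\<^sup>+a. indicator {y..} (bt s a) \<partial>Exp1)"
  proof -
    have "(\<integral>\<^sup>+a. indicator {y..} (bt s a) \<partial>Exp1) = (\<integral>\<^sup>+a. indicator {a. y \<le> bt s a} a \<partial>Exp1)"
      by (intro nn_integral_cong) (auto split: split_indicator)
    then show ?thesis by simp
  qed
  also have "\<dots> = (\<integral>\<^sup>+r\<in>{y..}. ennreal (f r * exp (- (F r - F s))) \<partial>lborel)"
    using assms by (subst nn_integral_bt) (auto intro!: nn_integral_cong split: split_indicator)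
  finally show ?thesis using nn_integral_birth_density[OF assms] by simp
qed

text \<open>Total version of \<open>bd_step\<close>: birth times are finite here, so there is always
  a next jump. As there, ties go to the death clock, and state 0 ignores it.\<close>

definition step :: "real \<Rightarrow> real \<Rightarrow> real \<times> nat \<Rightarrow> real \<times> nat" where
  "step a b = (\<lambda>(s, k). if k = 0 \<or> bt s a < s + b / real k then (bt s a, Suc k) else (s + b / real k, k - 1))"

definition P :: "(real \<times> nat \<Rightarrow> ennreal) \<Rightarrow> real \<times> nat \<Rightarrow> ennreal" where
  "P u x = (\<integral>\<^sup>+a. \<integral>\<^sup>+b. u (step a b x) \<partial>Exp1 \<partial>Exp1)"

text \<open>Competing clocks: the first jump is at time \<open>r\<close> with density survival
  probability times rate, where the rate is \<open>f r\<close> for a birth and \<open>k\<close> for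
  a death. The proof splits by the clock that rings first.\<close>

lemma P_eq:
  assumes [measurable]: "\<And>k. (\<lambda>t. u (t, k)) \<in> borel_measurable borel"
  shows "P u (s, k) = (\<integral>\<^sup>+r\<in>{s..}. ennreal (exp (- (F r - F s) - real k * (r - s))) *
           (ennreal (f r) * u (r, Suc k) + of_nat k * u (r, k - 1)) \<partial>lborel)"
proof (cases "k = 0")
  case True
  interpret Exp1: prob_space Exp1 by (rule prob_space_Exp1)
  have "P u (s, k) = (\<integral>\<^sup>+a. u (bt s a, Suc 0) \<partial>Exp1)"
    using True Exp1.emeasure_space_1 by (simp add: P_def step_def)
  then show ?thesis using True
    by (subst (asm) nn_integral_bt) (auto intro!: nn_integral_cong simp: ennreal_mult' nonneg mult_ac)
next
  case False
  interpret Exp1: prob_space Exp1 by (rule prob_space_Exp1)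
  interpret pair_sigma_finite Exp1 Exp1 ..
  define d where "d = real k"
  have d: "d > 0" using False by (simp add: d_def)
  define w1 where "w1 r = u (r, Suc k)" for r
  define w2 where "w2 r = u (r, k - 1)" for r
  have [measurable]: "w1 \<in> borel_measurable borel" "w2 \<in> borel_measurable borel"
    unfolding w1_def w2_def by measurable
  have "P u (s, k) = (\<integral>\<^sup>+a. \<integral>\<^sup>+b. w1 (bt s a) * indicator {d * (bt s a - s)<..} b
      + w2 (s + b / d) * indicator {a. s + b / d \<le> bt s a} a \<partial>Exp1 \<partial>Exp1)"
    unfolding P_def step_def w1_def w2_def using False d
    by (intro nn_integral_cong) (auto simp: d_def field_simps split: split_indicator)
  also have "\<dots> = (\<integral>\<^sup>+a. (\<integral>\<^sup>+b. w1 (bt s a) * indicator {d * (bt s a - s)<..} b \<partial>Exp1)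
       + (\<integral>\<^sup>+b. w2 (s + b / d) * indicator {a. s + b / d \<le> bt s a} a \<partial>Exp1) \<partial>Exp1)"
    by (intro nn_integral_cong nn_integral_add) (auto simp: indicator_def)
  also have "\<dots> = (\<integral>\<^sup>+a. \<integral>\<^sup>+b. w1 (bt s a) * indicator {d * (bt s a - s)<..} b \<partial>Exp1 \<partial>Exp1)
       + (\<integral>\<^sup>+a. \<integral>\<^sup>+b. w2 (s + b / d) * indicator {a. s + b / d \<le> bt s a} a \<partial>Exp1 \<partial>Exp1)"
    by (intro nn_integral_add) (auto simp: indicator_def)
  also have "(\<integral>\<^sup>+a. \<integral>\<^sup>+b. w1 (bt s a) * indicator {d * (bt s a - s)<..} b \<partial>Exp1 \<partial>Exp1)
      = (\<integral>\<^sup>+a. w1 (bt s a) * ennreal (exp (- d * (bt s a - s))) \<partial>Exp1)"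
    using d bt_ge[of s] by (intro nn_integral_cong) (simp add: nn_integral_cmult_indicator emeasure_Exp1_greaterThan)
  also have "\<dots> = (\<integral>\<^sup>+r\<in>{s..}. ennreal (f r * exp (- (F r - F s))) * (w1 r * ennreal (exp (- d * (r - s)))) \<partial>lborel)"
    by (rule nn_integral_bt) measurable
  \<comment> \<open>In the death term the order of integration is exchanged, so that for a fixed
    death time only the tail of the birth clock is needed.\<close>
  also have "(\<integral>\<^sup>+a. \<integral>\<^sup>+b. w2 (s + b / d) * indicator {a. s + b / d \<le> bt s a} a \<partial>Exp1 \<partial>Exp1)
      = (\<integral>\<^sup>+b. \<integral>\<^sup>+a. w2 (s + b / d) * indicator {a. s + b / d \<le> bt s a} a \<partial>Exp1 \<partial>Exp1)"
    by (rule Fubini') (auto simp: indicator_def)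
  also have "\<dots> = (\<integral>\<^sup>+b. w2 (s + b / d) * ennreal (exp (- (F (s + b / d) - F s))) \<partial>Exp1)"
    using AE_Exp1_pos d
    by (intro nn_integral_cong_AE, elim AE_mp) (intro AE_I2, simp add: nn_integral_cmult_indicator emeasure_bt_ge)
  also have "\<dots> = (\<integral>\<^sup>+b. exponential_density 1 b * (w2 (s + b / d) * ennreal (exp (- (F (s + b / d) - F s)))) \<partial>lborel)"
    by (subst nn_integral_density) auto
  \<comment> \<open>Substituting \<open>b = d * (r - s)\<close> passes from the death clock to the
    jump time \<open>r\<close>; the Jacobian \<open>d\<close> is the death rate.\<close>
  also have "\<dots> = ennreal d * (\<integral>\<^sup>+r. exponential_density 1 (- (d * s) + d * r) *
      (w2 (s + (- (d * s) + d * r) / d) * ennreal (exp (- (F (s + (- (d * s) + d * r) / d) - F s)))) \<partial>lborel)"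
    using d by (subst nn_integral_real_affine[where c=d and t="- (d * s)"]) auto
  also have "\<dots> = (\<integral>\<^sup>+r\<in>{s..}. ennreal d * (ennreal (exp (- (F r - F s))) * (w2 r * ennreal (exp (- d * (r - s))))) \<partial>lborel)"
    using d by (subst nn_integral_cmult[symmetric])
      (auto intro!: nn_integral_cong simp: exponential_density_def field_simps split: split_indicator)
  also have "(\<integral>\<^sup>+r\<in>{s..}. ennreal (f r * exp (- (F r - F s))) * (w1 r * ennreal (exp (- d * (r - s)))) \<partial>lborel)
     + (\<integral>\<^sup>+r\<in>{s..}. ennreal d * (ennreal (exp (- (F r - F s))) * (w2 r * ennreal (exp (- d * (r - s))))) \<partial>lborel)
     = (\<integral>\<^sup>+r\<in>{s..}. ennreal (exp (- (F r - F s) - d * (r - s))) *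
           (ennreal (f r) * w1 r + of_nat k * w2 r) \<partial>lborel)"
  proof (subst nn_integral_add[symmetric])
    have "exp (- (F r - F s) - d * (r - s)) = exp (- (F r - F s)) * exp (- d * (r - s))" for r
      by (simp flip: exp_add)
    then show "(\<integral>\<^sup>+r. ennreal (f r * exp (- (F r - F s))) * (w1 r * ennreal (exp (- d * (r - s)))) * indicator {s..} r
       + ennreal d * (ennreal (exp (- (F r - F s))) * (w2 r * ennreal (exp (- d * (r - s))))) * indicator {s..} r \<partial>lborel)
       = (\<integral>\<^sup>+r\<in>{s..}. ennreal (exp (- (F r - F s) - d * (r - s))) * (ennreal (f r) * w1 r + of_nat k * w2 r) \<partial>lborel)"
      by (intro nn_integral_cong)
        (simp add: ennreal_mult nonneg distrib_left distrib_right mult_ac d_def ennreal_of_nat_eq_real_of_nat)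
  qed auto
  finally show ?thesis by (simp add: d_def w1_def w2_def)
qed

end

section \<open>Harmonic functions of the jump chain\<close>

text \<open>This is the tangent line inequality at \<open>w\<close> for
  \<open>y * exp (- y)\<close>, evaluated at \<open>w + d\<close> and multiplied by
  \<open>exp w\<close>. The difference of the two sides is affine in \<open>w\<close> with slope
  \<open>d - 1 + exp (- d)\<close>, which is nonnegative, so \<open>w = 2\<close> is the worst
  case.\<close>

lemma exp_convexity_bound:
  fixes d w :: real
  assumes "0 \<le> d" "2 \<le> w"
  shows "(w + d) * (1 - exp (- d)) \<le> w * d"
proof -
  \<comment> \<open>\<open>\<psi> d\<close> is the right side minus the left side for
    \<open>w = 2\<close>; it starts from 0 at \<open>d = 0\<close>.\<close>
  define \<psi> where "\<psi> y = y - 2 + (2 + y) * exp (- y)" for y :: real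
  have "\<psi> 0 \<le> \<psi> d"
  proof (rule DERIV_nonneg_imp_nondecreasing[OF assms(1)])
    fix y :: real assume y: "0 \<le> y" "y \<le> d"
    have "(\<psi> has_real_derivative 1 - (1 + y) * exp (- y)) (at y)"
      unfolding \<psi>_def by (auto intro!: derivative_eq_intros simp: algebra_simps)
    moreover have "(1 + y) * exp (- y) \<le> exp y * exp (- y)"
      by (intro mult_right_mono) auto
    then have "(1 + y) * exp (- y) \<le> 1" by (simp flip: exp_add)
    ultimately show "\<exists>D. (\<psi> has_real_derivative D) (at y) \<and> 0 \<le> D" by fastforce
  qed
  then have "0 \<le> \<psi> d" by (simp add: \<psi>_def)
  moreover have "2 * (d - 1 + exp (- d)) \<le> w * (d - 1 + exp (- d))"
    using assms exp_ge_add_one_self[of "- d"] by (intro mult_right_mono) auto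
  ultimately show ?thesis by (simp add: \<psi>_def algebra_simps)
qed

lemma x_exp_minus_le_one: "x * exp (- x) \<le> (1::real)"
proof -
  have "x * exp (- x) \<le> exp x * exp (- x)"
    by (intro mult_right_mono) (use exp_ge_add_one_self[of x] in linarith, simp)
  then show ?thesis by (simp flip: exp_add)
qed

text \<open>For nonnegative \<open>x\<close>, \<open>exp (x / 2)\<close> is at least the square of
  \<open>1 + x / 4\<close>, which exceeds \<open>x\<close> by the square of
  \<open>x / 4 - 1\<close>.\<close>

lemma x_exp_minus_le_exp_half: "x * exp (- x) \<le> exp (- x / 2)" for x :: real
proof -
  have "x \<le> exp (x / 2)"
  proof (cases "0 \<le> x")
    case True
    have "(1 + x / 4)\<^sup>2 \<le> (exp (x / 4))\<^sup>2"
      using True by (intro power_mono) auto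
    also have "(exp (x / 4))\<^sup>2 = exp (x / 2)" by (simp add: power2_eq_square flip: exp_add)
    finally have "1 + x / 2 + (x / 4)\<^sup>2 \<le> exp (x / 2)"
      by (simp add: power2_eq_square algebra_simps)
    moreover have "0 \<le> (x / 4 - 1)\<^sup>2" by simp
    ultimately show ?thesis by (simp add: power2_eq_square algebra_simps)
  next
    case False
    then show ?thesis by (smt (verit) exp_gt_zero)
  qed
  then have "x * exp (- x) \<le> exp (x / 2) * exp (- x)" by (intro mult_right_mono) auto
  then show ?thesis by (simp flip: exp_add)
qed

section \<open>Expected number of upward jumps from 0\<close>

context birth_rate begin

text \<open>Individuals born before \<open>r\<close> and alive then survive until \<open>x\<close>
  with probability \<open>exp (r - x)\<close>.\<close>

lemma lam_split: "lam a x = lam r x + exp (r - x) * lam a r"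
  by (simp add: lam_def algebra_simps flip: exp_add)

lemma lam_antimono: "a \<le> r \<Longrightarrow> lam r x \<le> lam a x"
  using lam_split[of a x r] lam_nonneg[of a r] by simp

text \<open>The survival weight of each birth is at most 1. This keeps the subtraction for
  \<open>k = 0\<close> in \<open>U_first_jump\<close> nonnegative.\<close>

lemma lam_le_F: assumes "s \<le> x" shows "lam s x \<le> F x - F s"
proof -
  have "integral {s..x} (\<lambda>r. f r * exp r) \<le> integral {s..x} (\<lambda>r. f r * exp x)"
    by (intro integral_le integrable_times continuous_intros mult_left_mono nonneg) auto
  also have "\<dots> = exp x * (F x - F s)"
    using F_diff[OF assms] by simp
  finally have "exp (- x) * (L x - L s) \<le> exp (- x) * (exp x * (F x - F s))"
    using L_diff[OF assms] by (intro mult_left_mono) auto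
  then show ?thesis by (simp add: lam_def flip: exp_add mult.assoc)
qed

definition U :: "real set \<Rightarrow> real \<times> nat \<Rightarrow> ennreal" where
  "U W = (\<lambda>(t, k). \<integral>\<^sup>+x\<in>{t..} \<inter> W. ennreal (f x * h t k x) \<partial>lborel)"

lemma U_measurable: 
  assumes [measurable]: "W \<in> sets borel"
  shows "(\<lambda>t. U W (t, k)) \<in> borel_measurable borel"
proof -
  have "indicator ({t..} \<inter> W) x = (indicator {p. fst p \<le> snd p} (t, x) * indicator W x :: ennreal)" for t x
    by (auto split: split_indicator)
  then show ?thesis unfolding U_def split by simp
qed

end

context birth_rate_pos begin

text \<open>Integrate \<open>h_first_jump\<close> against \<open>f\<close> over \<open>W\<close> and
  exchange the integrals. The additional term in state 0 accounts for the first jump itself, which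
  is an upward jump from 0.\<close>

lemma U_first_jump:
  assumes [measurable]: "W \<in> sets borel"
  shows "U W (s, k) = P (U W) (s, k) +
    (if k = 0 then \<integral>\<^sup>+x\<in>{s..} \<inter> W. ennreal (f x * exp (- (F x - F s))) \<partial>lborel else 0)"
proof -
  define G where "G r = exp (- (F r - F s) - real k * (r - s))" for r
  define H where "H r x = f r * h r (Suc k) x + real k * h r (k - 1) x" for r x
  have [measurable]: "G \<in> borel_measurable borel" "(\<lambda>(r, x). H r x) \<in> borel_measurable (borel \<Otimes>\<^sub>M borel)"
    unfolding G_def H_def by measurable
  \<comment> \<open>\<open>J\<close> describes the region of integration: the first jump
    \<open>r\<close> lies between \<open>s\<close> and the time \<open>x\<close> of the counted
    upward jump.\<close>
  define J :: "real \<Rightarrow> real \<Rightarrow> ennreal" where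
    "J r x = indicator {p. s \<le> fst p \<and> fst p \<le> snd p} (r, x) * indicator W x" for r x
  have [measurable]: "(\<lambda>(r, x). J r x) \<in> borel_measurable (borel \<Otimes>\<^sub>M borel)"
    unfolding J_def by measurable
  have Gn: "0 \<le> G r" and Hn: "r \<le> x \<Longrightarrow> 0 \<le> H r x" for r x
    by (simp_all add: G_def H_def h_nonneg nonneg)
  have "P (U W) (s, k) = (\<integral>\<^sup>+r\<in>{s..}. ennreal (G r) *
     (ennreal (f r) * U W (r, Suc k) + of_nat k * U W (r, k - 1)) \<partial>lborel)"
    unfolding G_def by (rule P_eq) (rule U_measurable[OF assms])
  also have "\<dots> = (\<integral>\<^sup>+r. \<integral>\<^sup>+x. ennreal (f x) * ennreal (G r * H r x) * J r x \<partial>lborel \<partial>lborel)"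
  proof (rule nn_integral_cong)
    fix r
    have 1: "ennreal c * U W (r, j) = (\<integral>\<^sup>+x\<in>{r..} \<inter> W. ennreal (f x) * ennreal (c * h r j x) \<partial>lborel)"
      if "c \<ge> 0" for c j
      unfolding U_def split using that
      by (subst nn_integral_cmult[symmetric])
        (auto intro!: nn_integral_cong split: split_indicator simp: h_nonneg nonneg ennreal_mult mult_ac)
    have "ennreal (f r) * U W (r, Suc k) + of_nat k * U W (r, k - 1) =
      (\<integral>\<^sup>+x\<in>{r..} \<inter> W. ennreal (f x) * ennreal (H r x) \<partial>lborel)"
      unfolding ennreal_of_nat_eq_real_of_nat
      by (simp add: 1 nonneg flip: nn_integral_add)
        (auto intro!: nn_integral_cong split: split_indicator simp: H_def h_nonneg nonneg distrib_left simp flip: distrib_left)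
    then have "ennreal (G r) * (ennreal (f r) * U W (r, Suc k) + of_nat k * U W (r, k - 1)) * indicator {s..} r
      = (\<integral>\<^sup>+x. ennreal (G r) * (ennreal (f x) * ennreal (H r x) * indicator ({r..} \<inter> W) x) * indicator {s..} r \<partial>lborel)"
      by (simp add: nn_integral_cmult nn_integral_multc)
    also have "\<dots> = (\<integral>\<^sup>+x. ennreal (f x) * ennreal (G r * H r x) * J r x \<partial>lborel)"
    proof (rule nn_integral_cong)
      fix x
      show "ennreal (G r) * (ennreal (f x) * ennreal (H r x) * indicator ({r..} \<inter> W) x) * indicator {s..} r
        = ennreal (f x) * ennreal (G r * H r x) * J r x"
        by (cases "s \<le> r \<and> r \<le> x \<and> x \<in> W") (auto simp: J_def ennreal_mult[OF Gn Hn] mult_ac)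
    qed
    finally show "ennreal (G r) * (ennreal (f r) * U W (r, Suc k) + of_nat k * U W (r, k - 1)) * indicator {s..} r
       = (\<integral>\<^sup>+x. ennreal (f x) * ennreal (G r * H r x) * J r x \<partial>lborel)" .
  qed
  also have "\<dots> = (\<integral>\<^sup>+x. \<integral>\<^sup>+r. ennreal (f x) * ennreal (G r * H r x) * J r x \<partial>lborel \<partial>lborel)"
    by (rule lborel_pair.Fubini') measurable
  also have "\<dots> = (\<integral>\<^sup>+x\<in>{s..} \<inter> W. ennreal (f x) * ennreal (h s k x - G x * 0 ^ k) \<partial>lborel)"
  proof (rule nn_integral_cong)
    fix x
    have "(\<integral>\<^sup>+r. ennreal (f x) * ennreal (G r * H r x) * J r x \<partial>lborel)
      = (\<integral>\<^sup>+r. ennreal (f x) * indicator ({s..} \<inter> W) x * (ennreal (G r * H r x) * indicator {s..x} r) \<partial>lborel)"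
      by (intro nn_integral_cong) (auto split: split_indicator simp: J_def)
    also have "\<dots> = ennreal (f x) * indicator ({s..} \<inter> W) x * (\<integral>\<^sup>+r\<in>{s..x}. ennreal (G r * H r x) \<partial>lborel)"
      by (rule nn_integral_cmult) measurable
    also have "\<dots> = ennreal (f x) * ennreal (h s k x - G x * 0 ^ k) * indicator ({s..} \<inter> W) x"
      using h_first_jump[of s x k] by (auto simp: G_def H_def split: split_indicator)
    finally show "(\<integral>\<^sup>+r. ennreal (f x) * ennreal (G r * H r x) * J r x \<partial>lborel) =
      ennreal (f x) * ennreal (h s k x - G x * 0 ^ k) * indicator ({s..} \<inter> W) x" .
  qed
  also have "\<dots> + (if k = 0 then \<integral>\<^sup>+x\<in>{s..} \<inter> W. ennreal (f x * exp (- (F x - F s))) \<partial>lborel else 0) = U W (s, k)"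
  proof (cases "k = 0")
    case True
    have "ennreal (f x) * ennreal (h s k x - G x * 0 ^ k) + ennreal (f x * exp (- (F x - F s))) = ennreal (f x * h s k x)"
      if "s \<le> x" for x
      using that lam_le_F[of s x] True nonneg[of x]
      by (simp add: h_def G_def flip: ennreal_mult ennreal_plus) (simp add: algebra_simps)
    then show ?thesis using True
      by (auto simp: U_def simp flip: nn_integral_add intro!: nn_integral_cong split: split_indicator)
  next
    case False
    then show ?thesis
      by (auto simp: U_def zero_power ennreal_mult nonneg h_nonneg intro!: nn_integral_cong split: split_indicator)
  qed
  finally show ?thesis by simp
qed

lemma U_Suc_first_jump: "W \<in> sets borel \<Longrightarrow> k \<noteq> 0 \<Longrightarrow> P (U W) (s, k) = U W (s, k)"
  using U_first_jump[of W s k] by simp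

text \<open>For \<open>W = UNIV\<close> the additional term is the total mass of the birth density,
  namely 1.\<close>

lemma U_UNIV_first_jump: "P (U UNIV) (s, k) + (if k = 0 then 1 else 0) = U UNIV (s, k)"
  using U_first_jump[of UNIV s k] nn_integral_birth_density[of s s] by simp

text \<open>\<open>N R (t, k)\<close> bounds the expected number of jumps up to time \<open>R\<close> from state \<open>k\<close> at time \<open>t\<close>, since
  every death is preceded by a birth or by the initial presence of the individual.\<close>

definition N :: "real \<Rightarrow> real \<times> nat \<Rightarrow> ennreal" where
  "N R = (\<lambda>(t, k). ennreal (real k + 1 + 2 * (F R - F t)) * indicator {..R} t)"

lemma N_measurable: "(\<lambda>t. N R (t, k)) \<in> borel_measurable borel"
  unfolding N_def by simp

text \<open>A birth raises the state part of \<open>N\<close> by 1 and a death lowers it by 1. With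
  weight 2 on \<open>F\<close>, the integral over the first jump is exact with antiderivative
  \<open>- (G r * (real k + 2 * (F R - F r)))\<close>.\<close>

lemma N_first_jump: "P (N R) (s, k) + indicator {..R} s \<le> N R (s, k)"
proof -
  define G where "G r = exp (- (F r - F s) - real k * (r - s))" for r
  define p where "p r = G r * (real k + 2 + 2 * (F R - F r))" for r
  define q where "q r = G r * (real k * (real k + 2 * (F R - F r)))" for r
  have G: "G r \<ge> 0" for r by (simp add: G_def)
  have "P (N R) (s, k) = (\<integral>\<^sup>+r\<in>{s..}. ennreal (G r) *
     (ennreal (f r) * N R (r, Suc k) + of_nat k * N R (r, k - 1)) \<partial>lborel)"
    unfolding G_def by (rule P_eq) (rule N_measurable)
  also have "\<dots> = (\<integral>\<^sup>+r\<in>{s..R}. ennreal (f r * p r + q r) \<partial>lborel)"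
  proof (rule nn_integral_cong)
    fix r
    show "ennreal (G r) * (ennreal (f r) * N R (r, Suc k) + of_nat k * N R (r, k - 1)) * indicator {s..} r
       = ennreal (f r * p r + q r) * indicator {s..R} r"
    proof (cases "s \<le> r \<and> r \<le> R")
      case True
      then have FR: "F r \<le> F R" by (auto intro: F_mono)
      have "ennreal (G r) * (ennreal (f r) * N R (r, Suc k) + of_nat k * N R (r, k - 1))
        = ennreal (G r * (f r * (real (Suc k) + 1 + 2 * (F R - F r)) + real k * (real (k - 1) + 1 + 2 * (F R - F r))))"
      proof -
        define c where "c = real (Suc k) + 1 + 2 * (F R - F r)"
        define d where "d = real (k - 1) + 1 + 2 * (F R - F r)"
        have cd: "0 \<le> c" "0 \<le> d" using FR by (auto simp: c_def d_def)
        have "N R (r, Suc k) = ennreal c" "N R (r, k - 1) = ennreal d"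
          using True by (auto simp: N_def c_def d_def)
        then show ?thesis
          unfolding c_def[symmetric] d_def[symmetric] using cd G[of r] nonneg[of r]
          by (simp add: ennreal_of_nat_eq_real_of_nat ennreal_mult)
      qed
      also have "\<dots> = ennreal (f r * p r + q r)"
        by (cases k) (simp_all add: p_def q_def algebra_simps)
      finally show ?thesis using True by simp
    qed (auto simp: N_def split: split_indicator)
  qed
  finally have PN: "P (N R) (s, k) = (\<integral>\<^sup>+r\<in>{s..R}. ennreal (f r * p r + q r) \<partial>lborel)" .
  show ?thesis
  proof (cases "s \<le> R")
    case True
    have "(\<integral>\<^sup>+r\<in>{s..R}. ennreal (f r * p r + q r) \<partial>lborel)
      = ennreal (- (G R * (real k + 2 * (F R - F R))) - - (G s * (real k + 2 * (F R - F s))))"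
    proof (rule nn_FTC_mono[where \<Phi>="\<lambda>r. - (G r * (real k + 2 * (F R - F r)))"])
      fix r assume r: "isCont f r" "s < r" "r < R"
      have "(G has_real_derivative - (f r + real k) * G r) (at r)"
        unfolding G_def using r by (auto intro!: derivative_eq_intros simp: algebra_simps)
      then show "((\<lambda>r. - (G r * (real k + 2 * (F R - F r)))) has_real_derivative f r * p r + q r) (at r)"
        using r by (auto intro!: derivative_eq_intros simp: p_def q_def algebra_simps)
    next
      fix r assume "s \<le> r" "r \<le> R"
      then have "F r \<le> F R" by (auto intro: F_mono)
      then show "0 \<le> f r * p r + q r" using G[of r] nonneg[of r] by (simp add: p_def q_def)
    qed (auto simp: True mono p_def q_def G_def intro!: continuous_intros)
    \<comment> \<open>The boundary term at \<open>R\<close> is nonpositive and is dropped; at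
      \<open>s\<close> the factor \<open>G s\<close> is 1.\<close>
    also have "\<dots> \<le> ennreal (real k + 2 * (F R - F s))"
      using G[of R] by (intro ennreal_leI) (simp add: G_def)
    finally have "P (N R) (s, k) + 1 \<le> ennreal (real k + 2 * (F R - F s)) + 1"
      unfolding PN by (rule add_right_mono)
    also have "\<dots> = ennreal (real k + 1 + 2 * (F R - F s))"
      using F_mono[OF True] by (simp flip: ennreal_1 ennreal_plus add: algebra_simps)
    finally show ?thesis using True by (simp add: N_def)
  next
    case False
    then show ?thesis unfolding PN by simp
  qed
qed

end

section \<open>Bounds on the expected number of upward jumps\<close>

context birth_rate begin

text \<open>Since \<open>lam r\<close> has derivative \<open>f - lam r\<close>, the integrand is the
  derivative of \<open>- exp (- lam r x)\<close>, which takes values between -1 and 0.\<close>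

lemma nn_integral_excess:
  "(\<integral>\<^sup>+x\<in>{r..} \<inter> {..R}. ennreal ((f x - lam r x) * exp (- lam r x)) \<partial>lborel) \<le> 1"
proof (cases "r \<le> R")
  case True
  have "(\<integral>\<^sup>+x\<in>{r..R}. ennreal (f x * exp (- lam r x) + - (lam r x * exp (- lam r x))) \<partial>lborel)
    = ennreal (- exp (- lam r R) - - exp (- lam r r))"
    using lam_le[of r]
    by (intro nn_FTC_mono[where \<Phi>="\<lambda>x. - exp (- lam r x)"])
      (auto simp: True mono algebra_simps intro!: continuous_intros derivative_eq_intros DERIV_lam mult_left_mono)
  also have "\<dots> \<le> 1" by (simp add: lam_def flip: ennreal_1)
  finally show ?thesis by (simp add: algebra_simps atLeastAtMost_def)
qed (auto intro!: order_trans[OF nn_integral_mono[where v="\<lambda>_. 0"]])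

text \<open>Split \<open>f\<close> into \<open>f - lam r\<close> and \<open>lam r\<close>. The first
  part contributes at most 1 by \<open>nn_integral_excess\<close>. The second contributes at most 1
  on the first unit of time and 4 up to time \<open>e\<close>, and is afterwards dominated by the
  integrand for the start at time 0.\<close>

lemma U_zero_le:
  assumes "0 \<le> r"
  shows "U {..R} (r, 0) \<le> 6 + ennreal (exp 1) * U {..R} (0, 0)"
proof -
  define l where "l = lam 0 r"
  have l: "0 \<le> l" "l \<le> f r" using assms by (auto simp: l_def lam_nonneg lam_le)
  \<comment> \<open>\<open>e\<close> is chosen so that \<open>l * exp (r - e) = l / (1 + l)\<close>,
    which is at most 1: after \<open>e\<close> the means \<open>lam 0 x\<close> and
    \<open>lam r x\<close> differ by at most 1.\<close>
  define e where "e = r + ln (1 + l)"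
  have e: "r \<le> e" using l by (simp add: e_def)
  have pw: "f x * exp (- lam r x) \<le> (f x - lam r x) * exp (- lam r x) + (indicator {r..r + 1} x
      + (exp (- l / 4) * indicator {r..e} x + exp 1 * (f x * exp (- lam 0 x))))" if x: "r \<le> x" for x
  proof -
    define m where "m = lam r x"
    have m0: "0 \<le> m" using x by (simp add: m_def lam_nonneg)
    have fx: "0 \<le> exp 1 * (f x * exp (- lam 0 x))" by (simp add: nonneg)
    \<comment> \<open>In the first range \<open>m * exp (- m)\<close> is at most 1. In the second,
      \<open>m\<close> is at least \<open>l / 2\<close>, which yields \<open>exp (- l / 4)\<close>.
      In the third, \<open>exp (- m)\<close> is at most \<open>exp 1 * exp (- lam 0 x)\<close> and
      \<open>m\<close> is at most \<open>f x\<close>.\<close>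
    consider "x \<le> r + 1" | "r + 1 < x" "x \<le> e" | "r + 1 < x" "e < x" by linarith
    then have "m * exp (- m) \<le> indicator {r..r + 1} x + (exp (- l / 4) * indicator {r..e} x + exp 1 * (f x * exp (- lam 0 x)))"
    proof cases
      case 1
      then show ?thesis using x_exp_minus_le_one[of m] x fx
        by (auto split: split_indicator intro: order_trans)
    next
      case 2
      have "exp (r - x) \<le> exp (- 1)" using 2 by simp
      also have "\<dots> \<le> 1 / 2"
        using exp_ge_add_one_self[of 1] by (simp add: exp_minus field_simps)
      finally have "l * (1 / 2) \<le> f r * (1 - exp (r - x))"
        using l by (intro mult_mono) auto
      also have "\<dots> \<le> m" using lam_bounds(1)[OF x] by (simp add: m_def)
      finally have "exp (- m / 2) \<le> exp (- l / 4)" by simp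
      then have "m * exp (- m) \<le> exp (- l / 4)" using x_exp_minus_le_exp_half[of m] by linarith
      then show ?thesis using x fx 2
        by (auto split: split_indicator)
    next
      case 3
      have "exp (r - x) \<le> exp (- ln (1 + l))" using 3 by (simp add: e_def)
      also have "\<dots> = 1 / (1 + l)" using l by (simp add: exp_minus field_simps)
      finally have "exp (r - x) * l \<le> 1 / (1 + l) * l" using l by (intro mult_right_mono) auto
      also have "\<dots> \<le> 1" using l by simp
      finally have "- m \<le> 1 + - lam 0 x"
        using lam_split[of 0 x r] by (simp add: l_def m_def)
      then have "exp (- m) \<le> exp 1 * exp (- lam 0 x)" by (simp flip: exp_add)
      then have "m * exp (- m) \<le> f x * (exp 1 * exp (- lam 0 x))"
        using m0 lam_le[OF x] by (intro mult_mono) (auto simp: m_def)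
      then show ?thesis using 3 by (auto split: split_indicator simp: mult_ac)
    qed
    then show ?thesis by (simp add: m_def algebra_simps)
  qed
  have "U {..R} (r, 0) \<le> (\<integral>\<^sup>+x. ennreal ((f x - lam r x) * exp (- lam r x)) * indicator ({r..} \<inter> {..R}) x
      + (indicator {r..r + 1} x + (ennreal (exp (- l / 4)) * indicator {r..e} x
      + ennreal (exp 1) * (ennreal (f x * h 0 0 x) * indicator ({0..} \<inter> {..R}) x))) \<partial>lborel)"
    unfolding U_def split
  proof (rule nn_integral_mono)
    fix x
    show "ennreal (f x * h r 0 x) * indicator ({r..} \<inter> {..R}) x \<le>
      ennreal ((f x - lam r x) * exp (- lam r x)) * indicator ({r..} \<inter> {..R}) x
      + (indicator {r..r + 1} x + (ennreal (exp (- l / 4)) * indicator {r..e} x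
      + ennreal (exp 1) * (ennreal (f x * h 0 0 x) * indicator ({0..} \<inter> {..R}) x)))"
    proof (cases "r \<le> x \<and> x \<le> R")
      case True
      have "ennreal (f x * h r 0 x) \<le> ennreal ((f x - lam r x) * exp (- lam r x) + (indicator {r..r + 1} x
        + (exp (- l / 4) * indicator {r..e} x + exp 1 * (f x * exp (- lam 0 x)))))"
        using pw[of x] True by (intro ennreal_leI) (simp add: h_def)
      also have "\<dots> = ennreal ((f x - lam r x) * exp (- lam r x)) + (ennreal (indicator {r..r + 1} x)
        + (ennreal (exp (- l / 4)) * ennreal (indicator {r..e} x) + ennreal (exp 1) * ennreal (f x * exp (- lam 0 x))))"
        using lam_le[of r x] True nonneg[of x] by (simp add: ennreal_mult)
      finally show ?thesis using True assms by (simp add: h_def ennreal_indicator)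
    qed auto
  qed
  also have "\<dots> = (\<integral>\<^sup>+x\<in>{r..} \<inter> {..R}. ennreal ((f x - lam r x) * exp (- lam r x)) \<partial>lborel)
      + ((\<integral>\<^sup>+x. indicator {r..r + 1} x \<partial>lborel) + ((\<integral>\<^sup>+x. ennreal (exp (- l / 4)) * indicator {r..e} x \<partial>lborel)
      + ennreal (exp 1) * U {..R} (0, 0)))"
    unfolding U_def split by (simp add: nn_integral_add nn_integral_cmult)
  also have "\<dots> \<le> 1 + (1 + (4 + ennreal (exp 1) * U {..R} (0, 0)))"
  proof (intro add_mono nn_integral_excess order_refl)
    \<comment> \<open>Length \<open>ln (1 + l)\<close> times height \<open>exp (- l / 4)\<close> is
      bounded uniformly in \<open>l\<close>, because \<open>y * exp (- y)\<close> never exceeds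
      1.\<close>
    have "ln (1 + l) \<le> l" using l by (simp add: ln_add_one_self_le_self)
    then have "exp (- (l / 4)) * ln (1 + l) \<le> 4 * (l / 4 * exp (- (l / 4)))"
      by (simp add: mult.commute mult_right_mono)
    also have "\<dots> \<le> 4" using x_exp_minus_le_one[of "l / 4"] by simp
    finally have "ennreal (exp (- (l / 4)) * ln (1 + l)) \<le> ennreal 4" by (rule ennreal_leI)
    then show "(\<integral>\<^sup>+x. ennreal (exp (- l / 4)) * indicator {r..e} x \<partial>lborel) \<le> 4"
      using e l by (simp add: nn_integral_cmult_indicator e_def ennreal_mult)
  qed simp
  also have "\<dots> = 6 + ennreal (exp 1) * U {..R} (0, 0)"
    by (simp add: add.assoc[symmetric])
  finally show ?thesis .
qed

text \<open>Up to time \<open>R\<close> the rate is at most \<open>f R\<close>, and \<open>h\<close>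
  is at most 1. The indicator lets \<open>no_explosion\<close> remove the remainder in
  \<open>visit_zero_bound\<close>.\<close>

lemma U_bounded:
  assumes "0 \<le> t"
  shows "U {..R} (t, k) \<le> ennreal (f R * \<bar>R\<bar>) * indicator {..R} t"
proof (cases "t \<le> R")
  case True
  have "U {..R} (t, k) \<le> (\<integral>\<^sup>+x. ennreal (f R) * indicator {0..R} x \<partial>lborel)"
    unfolding U_def split
  proof (rule nn_integral_mono)
    fix x
    have "f x * h t k x \<le> f R * 1" if "t \<le> x" "x \<le> R"
      unfolding h_def using that lam_nonneg[of t x] nonneg monoD[OF mono]
      by (intro mult_mono mult_le_one power_le_one) auto
    then show "ennreal (f x * h t k x) * indicator ({t..} \<inter> {..R}) x \<le> ennreal (f R) * indicator {0..R} x"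
      using assms by (auto split: split_indicator intro!: ennreal_leI)
  qed
  also have "\<dots> = ennreal (f R * \<bar>R\<bar>)"
    using True assms nonneg by (simp add: nn_integral_cmult_indicator ennreal_mult)
  finally show ?thesis using True by simp
next
  case False
  then show ?thesis unfolding U_def by simp
qed

lemma U_finite: "0 \<le> t \<Longrightarrow> U {..R} (t, k) < \<infinity>"
  by (rule le_less_trans[OF U_bounded]) (auto split: split_indicator)

text \<open>For large \<open>x\<close> the factor \<open>(1 - exp (t - x)) ^ k\<close> exceeds 1/2,
  and \<open>lam t x\<close> is at most \<open>lam 0 x\<close>. The constant pays for the times
  before that and does not depend on \<open>R\<close>.\<close>

lemma U_zero_le_U:
  assumes "0 \<le> t"
  shows "\<exists>c<\<infinity>. \<forall>R. U {..R} (0, 0) \<le> c + 2 * U {..R} (t, k)"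
proof -
  have "((\<lambda>x::real. (1 - exp (t - x)) ^ k) \<longlongrightarrow> (1 - 0) ^ k) at_top"
  proof (intro tendsto_intros)
    have "filterlim (\<lambda>x. t - x) at_bot at_top"
      unfolding filterlim_uminus_at_top[symmetric]
      using filterlim_tendsto_add_at_top[OF tendsto_const[of "- t"] filterlim_ident]
      by (simp add: filterlim_uminus_at_top)
    then show "((\<lambda>x. exp (t - x)) \<longlongrightarrow> 0) at_top"
      by (rule filterlim_compose[OF exp_at_bot])
  qed
  then have "\<forall>\<^sub>F x in at_top. 1 / 2 < (1 - exp (t - x)) ^ k"
    by (rule order_tendstoD) simp
  then obtain y0 where y0: "\<And>x. y0 \<le> x \<Longrightarrow> 1 / 2 < (1 - exp (t - x)) ^ k"
    by (auto simp: eventually_at_top_linorder)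
  define y where "y = max t y0"
  have "U {..R} (0, 0) \<le> U {..y} (0, 0) + 2 * U {..R} (t, k)" for R
  proof -
    have "U {..R} (0, 0) \<le> (\<integral>\<^sup>+x. ennreal (f x * h 0 0 x) * indicator ({0..} \<inter> {..y}) x
       + 2 * (ennreal (f x * h t k x) * indicator ({t..} \<inter> {..R}) x) \<partial>lborel)"
      unfolding U_def split
    proof (rule nn_integral_mono)
      fix x
      show "ennreal (f x * h 0 0 x) * indicator ({0..} \<inter> {..R}) x \<le>
        ennreal (f x * h 0 0 x) * indicator ({0..} \<inter> {..y}) x
        + 2 * (ennreal (f x * h t k x) * indicator ({t..} \<inter> {..R}) x)"
      proof (cases "y \<le> x \<and> x \<le> R")
        case True
        then have x: "t \<le> x" "y0 \<le> x" by (auto simp: y_def)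
        have "1 * exp (- lam 0 x) \<le> (2 * (1 - exp (t - x)) ^ k) * exp (- lam t x)"
          using y0[OF x(2)] lam_antimono[OF assms, of x] by (intro mult_mono) auto
        then have "f x * h 0 0 x \<le> f x * (2 * h t k x)"
          using nonneg[of x] by (intro mult_left_mono) (auto simp: h_def)
        then have "ennreal (f x * h 0 0 x) \<le> ennreal (2 * (f x * h t k x))"
          by (intro ennreal_leI) (simp add: mult_ac)
        also have "\<dots> = 2 * ennreal (f x * h t k x)"
          using nonneg[of x] h_nonneg[of t x k] x by (subst ennreal_mult) auto
        finally have "ennreal (f x * h 0 0 x) \<le> 2 * ennreal (f x * h t k x)" .
        then show ?thesis using True x by (auto split: split_indicator intro: order_trans)
      qed (auto split: split_indicator)
    qed
    also have "\<dots> = U {..y} (0, 0) + 2 * U {..R} (t, k)"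
      unfolding U_def split by (simp add: nn_integral_add nn_integral_cmult)
    finally show ?thesis .
  qed
  then show ?thesis using U_finite[of 0 y 0] by auto
qed

lemma U_LIMSEQ: "(\<lambda>n. U {..real n} (t, k)) \<longlonglongrightarrow> U UNIV (t, k)"
  unfolding U_def split
proof (rule nn_integral_LIMSEQ)
  show "incseq (\<lambda>n x. ennreal (f x * h t k x) * indicator ({t..} \<inter> {..real n}) x)"
    by (auto simp: incseq_def le_fun_def split: split_indicator)
  fix x
  have "\<forall>\<^sub>F n in sequentially. ennreal (f x * h t k x) * indicator ({t..} \<inter> {..real n}) x
     = ennreal (f x * h t k x) * indicator ({t..} \<inter> UNIV) x"
    using eventually_ge_at_top[of "nat \<lceil>x\<rceil>"]
    by eventually_elim (auto split: split_indicator simp: nat_le_iff ceiling_le_iff)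
  then show "(\<lambda>n. ennreal (f x * h t k x) * indicator ({t..} \<inter> {..real n}) x)
      \<longlonglongrightarrow> ennreal (f x * h t k x) * indicator ({t..} \<inter> UNIV) x"
    by (rule tendsto_eventually)
qed measurable

text \<open>Because \<open>lam 0 x\<close> is at most \<open>f x\<close>, divergence of the integral
  sends \<open>U {..real n} (0, 0)\<close> to infinity; \<open>U_zero_le_U\<close> carries this to
  every other start.\<close>

lemma eventually_U_large:
  assumes div: "(\<integral>\<^sup>+x\<in>{0..}. ennreal (exp (- f x) * f x) \<partial>lborel) = \<infinity>" and "0 \<le> t"
  shows "\<forall>\<^sub>F n in sequentially. 6 + ennreal (exp 1) * U {..real n} (0, 0) \<le> 16 * U {..real n} (t, k)"
proof -
  obtain c where c: "c < \<infinity>" "\<And>R. U {..R} (0, 0) \<le> c + 2 * U {..R} (t, k)"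
    using U_zero_le_U[OF assms(2)] by blast
  obtain c' where c': "c = ennreal c'" "0 \<le> c'" using c(1) by (cases c) auto
  have "(\<integral>\<^sup>+x\<in>{0..}. ennreal (exp (- f x) * f x) \<partial>lborel) \<le> U UNIV (0, 0)"
    unfolding U_def split using lam_le[of 0]
    by (auto intro!: nn_integral_mono ennreal_leI mult_left_mono nonneg
        simp: h_def mult.commute[of "exp _"] split: split_indicator)
  then have "U UNIV (0, 0) = \<infinity>" using div by (simp add: top_unique)
  then have "(\<lambda>n. U {..real n} (0, 0)) \<longlonglongrightarrow> \<infinity>" using U_LIMSEQ[of 0 0] by simp
  \<comment> \<open>The threshold suffices for the factor 16: with \<open>exp 1\<close> at most 3
    and \<open>a\<close> at most \<open>c' + 2 * b\<close>, it is enough that \<open>5 * a\<close>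
    is at least \<open>8 * c' + 6\<close>.\<close>
  then have "\<forall>\<^sub>F n in sequentially. ennreal (2 * c' + 6) < U {..real n} (0, 0)"
    by (rule order_tendstoD) simp
  then show ?thesis
  proof eventually_elim
    case (elim n)
    obtain a where a: "U {..real n} (0, 0) = ennreal a" "0 \<le> a"
      using U_finite[of 0 "real n" 0] by (cases "U {..real n} (0, 0)") auto
    obtain b where b: "U {..real n} (t, k) = ennreal b" "0 \<le> b"
      using U_finite[OF assms(2), of "real n" k] by (cases "U {..real n} (t, k)") auto
    have 1: "2 * c' + 6 < a" using elim unfolding a using c' by (subst (asm) ennreal_less_iff) auto
    have "ennreal a \<le> ennreal (c' + 2 * b)" using c(2)[of "real n"] a b c' by (simp add: ennreal_mult)
    then have 2: "a \<le> c' + 2 * b" using b c' by (subst (asm) ennreal_le_iff) auto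
    have "exp 1 * a \<le> 3 * a" using a exp_le by (intro mult_right_mono) auto
    then have "6 + exp 1 * a \<le> 16 * b" using 1 2 b a c' by linarith
    then have "ennreal (6 + exp 1 * a) \<le> ennreal (16 * b)" by (rule ennreal_leI)
    then show ?case unfolding a b using a b by (simp add: ennreal_mult)
  qed
qed

end

section \<open>Finiteness when the integral converges\<close>

context birth_rate_pos begin

lemma U_UNIV_finite:
  assumes conv: "(\<integral>\<^sup>+x\<in>{0..}. ennreal (exp (- f x) * f x) \<partial>lborel) < \<infinity>"
  shows "U UNIV (0, 1) < \<infinity>"
proof -
  define I where "I = (\<integral>\<^sup>+x\<in>{0..}. ennreal (exp (- f x) * f x) \<partial>lborel)"
  \<comment> \<open>If \<open>f\<close> stayed below 3, the integrand would be at least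
    \<open>exp (- 3) * f r\<close> on a half-line and the integral would diverge.\<close>
  obtain t0 where t0: "0 \<le> t0" "3 \<le> f t0"
  proof (rule ccontr)
    assume "\<not> thesis"
    then have lt: "f t < 3" if "0 \<le> t" for t using that \<open>\<And>t0. 0 \<le> t0 \<Longrightarrow> 3 \<le> f t0 \<Longrightarrow> thesis\<close> by force
    obtain r where r: "0 < f r" using pos by blast
    have "(\<integral>\<^sup>+x. ennreal (exp (- 3) * f r) * indicator {max 0 r..} x \<partial>lborel) \<le> I"
      unfolding I_def
    proof (rule nn_integral_mono)
      fix x
      have "exp (- 3) * f r \<le> exp (- f x) * f x" if "0 \<le> x" "r \<le> x"
        using lt[OF that(1)] monoD[OF mono that(2)] r by (intro mult_mono) auto
      then show "ennreal (exp (- 3) * f r) * indicator {max 0 r..} x \<le> ennreal (exp (- f x) * f x) * indicator {0..} x"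
        by (auto split: split_indicator intro!: ennreal_leI)
    qed
    moreover have "emeasure lborel {max 0 r..} = \<infinity>"
    proof -
      have "of_nat n \<le> emeasure lborel {max 0 r..}" for n
        using emeasure_mono[of "{max 0 r..max 0 r + real n}" "{max 0 r..}" lborel]
        by (simp add: ennreal_of_nat_eq_real_of_nat)
      then have "(SUP n. of_nat n) \<le> emeasure lborel {max 0 r..}" by (rule SUP_least)
      then show ?thesis by (simp add: ennreal_SUP_of_nat_eq_top top_unique)
    qed
    ultimately have "I = \<infinity>"
      using r by (simp add: nn_integral_cmult_indicator ennreal_mult_top top_unique)
    then show False using conv by (simp add: I_def)
  qed
  \<comment> \<open>Two time units after \<open>t0\<close> the mean is at least
    \<open>3 * (1 - exp (- 2))\<close>, hence at least 2, as \<open>exp_convexity_bound\<close>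
    requires.\<close>
  define t where "t = t0 + 2"
  have t: "0 \<le> t" using t0 by (simp add: t_def)
  define w where "w = lam 0"
  have w2: "2 \<le> w x" if x: "t \<le> x" for x
  proof -
    have "exp (t0 - x) \<le> exp (- 2)" using x by (simp add: t_def)
    also have "\<dots> \<le> 1 / 3"
      using exp_ge_add_one_self[of 2] by (simp add: exp_minus field_simps)
    finally have "3 * (2 / 3) \<le> f t0 * (1 - exp (t0 - x))" using t0 by (intro mult_mono) auto
    also have "\<dots> \<le> lam t0 x" using x by (intro lam_bounds) (simp add: t_def)
    also have "\<dots> \<le> w x" unfolding w_def by (rule lam_antimono[OF t0(1)])
    finally show ?thesis by simp
  qed
  have wf: "w x \<le> f x" if "t \<le> x" for x
    using lam_le[of 0 x] that t by (simp add: w_def)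
  \<comment> \<open>This is \<open>exp_convexity_bound\<close> with \<open>d = f x - w x\<close>,
    multiplied by \<open>exp (- w x)\<close>. The first term on the right is the derivative of
    \<open>- (1 + w) * exp (- w)\<close>.\<close>
  have key: "f x * exp (- w x) \<le> w x * (f x - w x) * exp (- w x) + exp (- f x) * f x" if "t \<le> x" for x
  proof -
    have "f x * (1 - exp (- (f x - w x))) \<le> w x * (f x - w x)"
      using exp_convexity_bound[of "f x - w x" "w x"] w2[OF that] wf[OF that] by simp
    then have "f x * (1 - exp (- (f x - w x))) * exp (- w x) \<le> w x * (f x - w x) * exp (- w x)"
      by (rule mult_right_mono) simp
    then show ?thesis by (simp add: algebra_simps flip: exp_add)
  qed
  have bound: "U {..real n} (0, 0) \<le> ennreal (f t * t) + (1 + I)" for n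
  proof -
    have "U {..real n} (0, 0) \<le> (\<integral>\<^sup>+x. ennreal (f t) * indicator {0..t} x +
      (ennreal (f x * (w x * exp (- w x)) + - (w x * w x * exp (- w x))) * indicator {t..max t (real n)} x
       + ennreal (exp (- f x) * f x) * indicator {0..} x) \<partial>lborel)"
      unfolding U_def split
    proof (rule nn_integral_mono)
      fix x
      consider "0 \<le> x" "x \<le> t" | "t < x" "x \<le> real n" | "\<not> (0 \<le> x \<and> x \<le> real n)" using t by linarith
      then show "ennreal (f x * h 0 0 x) * indicator ({0..} \<inter> {..real n}) x \<le> ennreal (f t) * indicator {0..t} x +
        (ennreal (f x * (w x * exp (- w x)) + - (w x * w x * exp (- w x))) * indicator {t..max t (real n)} x
         + ennreal (exp (- f x) * f x) * indicator {0..} x)"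
      proof cases
        case 1
        have "f x * h 0 0 x \<le> f t * 1"
          using 1 monoD[OF mono] lam_nonneg[of 0 x] nonneg by (intro mult_mono) (auto simp: h_def)
        then have "ennreal (f x * h 0 0 x) \<le> ennreal (f t)" by (intro ennreal_leI) simp
        then show ?thesis using 1 by (auto split: split_indicator intro: order_trans)
      next
        case 2
        have "ennreal (f x * h 0 0 x) \<le> ennreal ((f x * (w x * exp (- w x)) + - (w x * w x * exp (- w x))) + exp (- f x) * f x)"
          using key[of x] 2 by (intro ennreal_leI) (simp add: h_def w_def algebra_simps)
        also have "\<dots> = ennreal (f x * (w x * exp (- w x)) + - (w x * w x * exp (- w x))) + ennreal (exp (- f x) * f x)"
          using wf[of x] w2[of x] 2 nonneg[of x] by (intro ennreal_plus) (auto simp: mult_ac intro!: mult_right_mono)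
        finally show ?thesis using 2 t by (auto split: split_indicator intro: order_trans)
      qed auto
    qed
    also have "\<dots> = (\<integral>\<^sup>+x. ennreal (f t) * indicator {0..t} x \<partial>lborel) +
      ((\<integral>\<^sup>+x\<in>{t..max t (real n)}. ennreal (f x * (w x * exp (- w x)) + - (w x * w x * exp (- w x))) \<partial>lborel) + I)"
      unfolding I_def w_def by (simp add: nn_integral_add)
    also have "(\<integral>\<^sup>+x\<in>{t..max t (real n)}. ennreal (f x * (w x * exp (- w x)) + - (w x * w x * exp (- w x))) \<partial>lborel)
      = ennreal (- ((1 + w (max t (real n))) * exp (- w (max t (real n)))) - - ((1 + w t) * exp (- w t)))"
    proof (rule nn_FTC_mono[where \<Phi>="\<lambda>x. - ((1 + w x) * exp (- w x))"])
      fix x assume "isCont f x"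
      then show "((\<lambda>x. - ((1 + w x) * exp (- w x))) has_real_derivative
          f x * (w x * exp (- w x)) + - (w x * w x * exp (- w x))) (at x)"
        unfolding w_def by (auto intro!: derivative_eq_intros DERIV_lam simp: algebra_simps)
    next
      fix x assume "t \<le> x"
      then show "0 \<le> f x * (w x * exp (- w x)) + - (w x * w x * exp (- w x))"
        using wf[of x] w2[of x] by (auto simp: mult_ac intro!: mult_right_mono)
    qed (auto simp: mono w_def intro!: continuous_intros)
    \<comment> \<open>The upper boundary term is nonpositive, and \<open>1 + w t\<close> is at most
      \<open>exp (w t)\<close>.\<close>
    also have "\<dots> \<le> 1"
    proof -
      have "(1 + w t) * exp (- w t) \<le> exp (w t) * exp (- w t)" by (intro mult_right_mono) auto
      then have "(1 + w t) * exp (- w t) \<le> 1" by (simp flip: exp_add)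
      moreover have "0 \<le> (1 + w (max t (real n))) * exp (- w (max t (real n)))"
        using w2[of "max t (real n)"] by simp
      ultimately show ?thesis by (simp flip: ennreal_1 add: ennreal_le_iff)
    qed
    finally show ?thesis using t nonneg[of t]
      by (simp add: nn_integral_cmult_indicator ennreal_mult add_mono)
  qed
  \<comment> \<open>An initial individual only lowers \<open>h\<close>, so the bound for the start
    in state 0 suffices.\<close>
  have "U UNIV (0, 1) \<le> U UNIV (0, 0)"
    unfolding U_def split
    by (auto intro!: nn_integral_mono ennreal_leI mult_left_mono nonneg simp: h_def split: split_indicator)
  also have "\<dots> \<le> ennreal (f t * t) + (1 + I)"
    using U_LIMSEQ bound by (intro LIMSEQ_le_const2[OF U_LIMSEQ]) auto
  also have "\<dots> < \<infinity>" using conv by (simp add: I_def)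
  finally show ?thesis .
qed

end

section \<open>The jump chain\<close>

abbreviation state_space :: "(real \<times> nat) measure" where "state_space \<equiv> borel \<Otimes>\<^sub>M count_space UNIV"

lemma measurable_state_space:
  assumes [measurable]: "\<And>k. (\<lambda>t. u (t, k)) \<in> borel_measurable borel"
  shows "u \<in> borel_measurable state_space"
proof -
  have "(\<lambda>x. u (fst x, snd x)) \<in> borel_measurable state_space"
    by (rule measurable_compose_countable[where f="\<lambda>k x. u (fst x, k)" and g=snd]) measurable
  then show ?thesis by simp
qed

text \<open>These are the indices of the clocks that determine the first \<open>n\<close>
  jumps.\<close>

definition before :: "nat \<Rightarrow> (nat \<times> bool) set" where "before n = {..<n} \<times> UNIV"

context birth_rate_pos begin

lemma step_measurable [measurable (raw)]:
  assumes [measurable]: "a \<in> borel_measurable K" "b \<in> borel_measurable K" "x \<in> K \<rightarrow>\<^sub>M state_space"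
  shows "(\<lambda>\<omega>. step (a \<omega>) (b \<omega>) (x \<omega>)) \<in> K \<rightarrow>\<^sub>M state_space"
proof -
  have [measurable]: "(\<lambda>\<omega>. bt (fst (x \<omega>)) (a \<omega>)) \<in> borel_measurable K"
    using measurable_compose[of "\<lambda>\<omega>. (fst (x \<omega>), a \<omega>)" K, OF _ bt_measurable] by simp
  show ?thesis unfolding step_def split_beta' by measurable
qed

lemma P_measurable:
  assumes [measurable]: "u \<in> borel_measurable state_space"
  shows "P u \<in> borel_measurable state_space"
proof -
  interpret Exp1: prob_space Exp1 by (rule prob_space_Exp1)
  show ?thesis unfolding P_def[abs_def] by measurable
qed

text \<open>The chain is a function of the clock values instead of the sample point, so that
  dependence on finitely many clocks can be expressed through \<open>restrict\<close>.\<close>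

primrec chain :: "nat \<Rightarrow> (nat \<times> bool \<Rightarrow> real) \<Rightarrow> real \<times> nat" where
  "chain 0 e = (0, 1)"
| "chain (Suc n) e = step (e (n, True)) (e (n, False)) (chain n e)"

lemma chain_cong: "(\<And>i. i \<in> before n \<Longrightarrow> e i = e' i) \<Longrightarrow> chain n e = chain n e'"
  by (induction n) (auto simp: before_def)

lemma chain_measurable: "before n \<subseteq> J \<Longrightarrow> chain n \<in> PiM J (\<lambda>_. borel) \<rightarrow>\<^sub>M state_space"
proof (induction n)
  case (Suc n)
  then have J: "(n, b) \<in> J" for b by (auto simp: before_def)
  have [measurable]: "chain n \<in> PiM J (\<lambda>_. borel) \<rightarrow>\<^sub>M state_space"
    by (rule Suc.IH) (use Suc.prems in \<open>auto simp: before_def\<close>)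
  have [measurable]: "(\<lambda>e. e (n, b)) \<in> borel_measurable (PiM J (\<lambda>_. borel))" for b
    by (rule measurable_component_singleton[OF J])
  show ?case unfolding chain.simps[abs_def] by measurable
next
  case 0
  show ?case unfolding chain.simps[abs_def] by simp
qed

end

section \<open>The chain driven by random clocks and its Markov property\<close>

locale bd_process = birth_rate_pos f + prob_space M
  for f :: "real \<Rightarrow> real" and M :: "'a measure" +
  fixes E :: "nat \<Rightarrow> bool \<Rightarrow> 'a \<Rightarrow> real"
  assumes indep: "indep_vars (\<lambda>_. borel) (\<lambda>(n, b). E n b) UNIV"
    and expo: "\<And>n b. distributed M lborel (E n b) (exponential_density 1)"
begin

definition ev :: "'a \<Rightarrow> nat \<times> bool \<Rightarrow> real" where "ev \<omega> = (\<lambda>(n, b). E n b \<omega>)"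

definition X :: "nat \<Rightarrow> 'a \<Rightarrow> real \<times> nat" where "X n \<omega> = chain n (ev \<omega>)"

lemma E_measurable [measurable]: "E n b \<in> borel_measurable M"
  using distributed_measurable[OF expo[of n b]] by simp

lemma distr_E: "distr M borel (E n b) = Exp1"
  using distributed_distr_eq_density[OF expo[of n b]] by (simp cong: distr_cong)

lemma ev_measurable: "ev \<in> M \<rightarrow>\<^sub>M PiM UNIV (\<lambda>_. borel)"
proof (rule measurable_PiM_single')
  show "(\<lambda>\<omega>. ev \<omega> i) \<in> borel_measurable M" for i by (cases i) (simp add: ev_def)
qed auto

lemma X_measurable [measurable]: "X n \<in> M \<rightarrow>\<^sub>M state_space"
  unfolding X_def by (rule measurable_compose[OF ev_measurable chain_measurable]) simp

lemma AE_E_pos: "AE \<omega> in M. \<forall>n b. 0 < E n b \<omega>"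
  using distributed_exponential_AE_pos[OF expo] by (simp add: AE_all_countable)

lemma X_nonneg: "(\<And>n b. 0 < E n b \<omega>) \<Longrightarrow> 0 \<le> fst (X n \<omega>)"
proof (induction n)
  case (Suc n)
  obtain s k where sk: "X n \<omega> = (s, k)" by (cases "X n \<omega>")
  then have "0 \<le> s" using Suc by force
  moreover have "0 \<le> E n False \<omega> / real k" using Suc.prems[of n False] by simp
  ultimately show ?case
    using sk bt_ge[of s "E n True \<omega>"] by (auto simp: X_def step_def ev_def)
qed (simp add: X_def)

text \<open>The two clocks of step \<open>n\<close> are independent of the earlier clocks and of
  each other, so the history can be frozen while they are integrated out.\<close>

lemma nn_integral_history:
  assumes [measurable]: "g \<in> borel_measurable (PiM (before n) (\<lambda>_. borel) \<Otimes>\<^sub>M (borel \<Otimes>\<^sub>M borel))"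
  shows "(\<integral>\<^sup>+\<omega>. g (restrict (ev \<omega>) (before n), E n True \<omega>, E n False \<omega>) \<partial>M)
       = (\<integral>\<^sup>+\<omega>. \<integral>\<^sup>+a. \<integral>\<^sup>+b. g (restrict (ev \<omega>) (before n), a, b) \<partial>Exp1 \<partial>Exp1 \<partial>M)"
proof -
  interpret Exp1: prob_space Exp1 by (rule prob_space_Exp1)
  let ?B = "{(n, True), (n, False)}"
  let ?H = "PiM (before n) (\<lambda>_. borel :: real measure)" and ?K = "PiM ?B (\<lambda>_. borel :: real measure)"
  define hist where "hist \<omega> = restrict (ev \<omega>) (before n)" for \<omega>
  define now where "now \<omega> = restrict (ev \<omega>) ?B" for \<omega>
  have ev: "ev = (\<lambda>\<omega> i. (\<lambda>(n, b). E n b) i \<omega>)" by (auto simp: ev_def fun_eq_iff)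
  have ind: "indep_var ?H hist ?K now"
    unfolding hist_def now_def ev by (rule indep_var_restrict[OF indep]) (auto simp: before_def)
  have "indep_var borel ((\<lambda>e. e (n, True)) \<circ> (\<lambda>\<omega>. restrict (ev \<omega>) {(n, True)}))
      borel ((\<lambda>e. e (n, False)) \<circ> (\<lambda>\<omega>. restrict (ev \<omega>) {(n, False)}))"
    unfolding ev by (rule indep_var_compose[OF indep_var_restrict[OF indep]]) auto
  then have "indep_var borel (E n True) borel (E n False)"
    by (simp add: comp_def ev_def)
  then have dW: "distr M (borel \<Otimes>\<^sub>M borel) (\<lambda>\<omega>. (E n True \<omega>, E n False \<omega>)) = Exp1 \<Otimes>\<^sub>M Exp1"
    unfolding indep_var_distribution_eq by (simp add: distr_E)
  have [measurable]: "hist \<in> M \<rightarrow>\<^sub>M ?H" "now \<in> M \<rightarrow>\<^sub>M ?K"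
    using ind by (auto simp: indep_var_distribution_eq)
  interpret K: prob_space "distr M ?K now" by (rule prob_space_distr) measurable
  \<comment> \<open>\<open>g'\<close> reads both clocks from the block \<open>?B\<close>, since
    independence of the history is available for the whole block.\<close>
  define g' where "g' = (\<lambda>(z, e). g (z, e (n, True), e (n, False)))"
  have [measurable]: "g' \<in> borel_measurable (?H \<Otimes>\<^sub>M ?K)" unfolding g'_def by measurable
  have "(\<integral>\<^sup>+\<omega>. g (hist \<omega>, E n True \<omega>, E n False \<omega>) \<partial>M) = (\<integral>\<^sup>+\<omega>. g' (hist \<omega>, now \<omega>) \<partial>M)"
    by (simp add: g'_def now_def ev_def)
  also have "\<dots> = (\<integral>\<^sup>+p. g' p \<partial>distr M (?H \<Otimes>\<^sub>M ?K) (\<lambda>\<omega>. (hist \<omega>, now \<omega>)))"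
    by (subst nn_integral_distr) auto
  also have "\<dots> = (\<integral>\<^sup>+p. g' p \<partial>(distr M ?H hist \<Otimes>\<^sub>M distr M ?K now))"
    using ind unfolding indep_var_distribution_eq by simp
  also have "\<dots> = (\<integral>\<^sup>+z. \<integral>\<^sup>+e. g' (z, e) \<partial>distr M ?K now \<partial>distr M ?H hist)"
    by (rule K.nn_integral_fst[symmetric]) measurable
  also have "\<dots> = (\<integral>\<^sup>+\<omega>. \<integral>\<^sup>+e. g' (hist \<omega>, e) \<partial>distr M ?K now \<partial>M)"
    by (rule nn_integral_distr) measurable
  also have "\<dots> = (\<integral>\<^sup>+\<omega>. \<integral>\<^sup>+a. \<integral>\<^sup>+b. g (hist \<omega>, a, b) \<partial>Exp1 \<partial>Exp1 \<partial>M)"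
  proof (rule nn_integral_cong)
    fix \<omega> assume "\<omega> \<in> space M"
    then have z: "hist \<omega> \<in> space ?H" by (rule measurable_space[rotated]) measurable
    have [measurable]: "(\<lambda>w. g (hist \<omega>, w)) \<in> borel_measurable (borel \<Otimes>\<^sub>M borel)"
      by (rule measurable_compose[OF measurable_Pair1'[OF z] assms])
    have [measurable]: "(\<lambda>e. g' (hist \<omega>, e)) \<in> borel_measurable ?K"
      by (rule measurable_compose[OF measurable_Pair1'[OF z]]) measurable
    have "(\<integral>\<^sup>+e. g' (hist \<omega>, e) \<partial>distr M ?K now) = (\<integral>\<^sup>+\<omega>'. g' (hist \<omega>, now \<omega>') \<partial>M)"
      by (rule nn_integral_distr) measurable
    also have "\<dots> = (\<integral>\<^sup>+\<omega>'. g (hist \<omega>, E n True \<omega>', E n False \<omega>') \<partial>M)"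
      by (simp add: g'_def now_def ev_def)
    also have "\<dots> = (\<integral>\<^sup>+w. g (hist \<omega>, w) \<partial>(Exp1 \<Otimes>\<^sub>M Exp1))"
      unfolding dW[symmetric] by (rule nn_integral_distr[symmetric]) measurable
    also have "\<dots> = (\<integral>\<^sup>+a. \<integral>\<^sup>+b. g (hist \<omega>, a, b) \<partial>Exp1 \<partial>Exp1)"
      by (rule Exp1.nn_integral_fst[symmetric]) simp
    finally show "(\<integral>\<^sup>+e. g' (hist \<omega>, e) \<partial>distr M ?K now) = (\<integral>\<^sup>+a. \<integral>\<^sup>+b. g (hist \<omega>, a, b) \<partial>Exp1 \<partial>Exp1)" .
  qed
  finally show ?thesis by (simp add: hist_def)
qed

definition avoids :: "nat \<Rightarrow> nat \<Rightarrow> 'a set" where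
  "avoids m n = {\<omega>\<in>space M. \<forall>i\<in>{m..<n}. snd (X i \<omega>) \<noteq> 0}"

lemma avoids_measurable [measurable]: "avoids m n \<in> sets M"
  unfolding avoids_def by measurable

text \<open>The event concerns indices below \<open>m\<close>, hence at most \<open>n\<close>, and
  so is a function of the clocks before step \<open>n\<close>. The bound on \<open>m\<close> lets it
  involve \<open>X n\<close> itself.\<close>

lemma markov_property:
  assumes "m \<le> Suc n" and [measurable]: "u \<in> borel_measurable state_space"
  shows "(\<integral>\<^sup>+\<omega>\<in>avoids l m. u (X (Suc n) \<omega>) \<partial>M) = (\<integral>\<^sup>+\<omega>\<in>avoids l m. P u (X n \<omega>) \<partial>M)"
proof -
  define Q where "Q z \<longleftrightarrow> (\<forall>i\<in>{l..<m}. snd (chain i z) \<noteq> 0)" for z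
  let ?H = "PiM (before n) (\<lambda>_. borel :: real measure)"
  have sub: "before i \<subseteq> before n" if "i < m" for i using that assms(1) by (auto simp: before_def)
  have [measurable]: "chain n \<in> ?H \<rightarrow>\<^sub>M state_space" by (rule chain_measurable) simp
  have [measurable]: "Measurable.pred ?H Q"
    unfolding Q_def
  proof (rule pred_intros_finite)
    fix i assume "i \<in> {l..<m}"
    then have [measurable]: "chain i \<in> ?H \<rightarrow>\<^sub>M state_space" by (intro chain_measurable sub) simp
    show "Measurable.pred ?H (\<lambda>z. snd (chain i z) \<noteq> 0)" by measurable
  qed simp
  have chain_restrict: "chain i (restrict e (before n)) = chain i e" if "i \<le> n" for i e
    using that by (intro chain_cong) (auto simp: before_def)
  have Q: "indicator {z. Q z} (restrict (ev \<omega>) (before n)) = (indicator (avoids l m) \<omega> :: ennreal)" if "\<omega> \<in> space M" for \<omega>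
    using that assms(1) by (auto simp: Q_def avoids_def X_def chain_restrict split: split_indicator)
  define g where "g = (\<lambda>(z, a, b). u (step a b (chain n z)) * indicator {z. Q z} z)"
  have 1: "(\<lambda>p. step (fst (snd p)) (snd (snd p)) (chain n (fst p))) \<in> ?H \<Otimes>\<^sub>M (borel \<Otimes>\<^sub>M borel) \<rightarrow>\<^sub>M state_space"
    by measurable
  have 2: "(\<lambda>z. indicator {z. Q z} z :: ennreal) \<in> borel_measurable ?H"
    by measurable
  have g: "g \<in> borel_measurable (?H \<Otimes>\<^sub>M (borel \<Otimes>\<^sub>M borel))"
    unfolding g_def split_beta'
    by (intro borel_measurable_times_ennreal measurable_compose[OF 1] measurable_compose[OF measurable_fst 2]) measurable
  have "(\<integral>\<^sup>+\<omega>\<in>avoids l m. u (X (Suc n) \<omega>) \<partial>M) =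
      (\<integral>\<^sup>+\<omega>. g (restrict (ev \<omega>) (before n), E n True \<omega>, E n False \<omega>) \<partial>M)"
    by (intro nn_integral_cong) (simp add: g_def Q chain_restrict X_def, simp add: ev_def)
  also have "\<dots> = (\<integral>\<^sup>+\<omega>. \<integral>\<^sup>+a. \<integral>\<^sup>+b. g (restrict (ev \<omega>) (before n), a, b) \<partial>Exp1 \<partial>Exp1 \<partial>M)"
    by (rule nn_integral_history[OF g])
  also have "\<dots> = (\<integral>\<^sup>+\<omega>\<in>avoids l m. P u (X n \<omega>) \<partial>M)"
  proof (rule nn_integral_cong)
    fix \<omega> assume "\<omega> \<in> space M"
    then have "(\<integral>\<^sup>+a. \<integral>\<^sup>+b. g (restrict (ev \<omega>) (before n), a, b) \<partial>Exp1 \<partial>Exp1) =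
      (\<integral>\<^sup>+a. \<integral>\<^sup>+b. u (step a b (X n \<omega>)) * indicator (avoids l m) \<omega> \<partial>Exp1 \<partial>Exp1)"
      by (simp add: g_def Q chain_restrict X_def)
    also have "\<dots> = P u (X n \<omega>) * indicator (avoids l m) \<omega>"
      by (cases "\<omega> \<in> avoids l m") (auto simp: P_def)
    finally show "(\<integral>\<^sup>+a. \<integral>\<^sup>+b. g (restrict (ev \<omega>) (before n), a, b) \<partial>Exp1 \<partial>Exp1) = P u (X n \<omega>) * indicator (avoids l m) \<omega>" .
  qed
  finally show ?thesis .
qed

text \<open>A Lyapunov argument: the expectation of \<open>u\<close> along the chain falls in each
  step by at least the expected cost \<open>c\<close>. Telescoping and nonnegativity of
  \<open>u\<close> bound the total cost by the initial value.\<close>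

lemma drift:
  assumes [measurable]: "u \<in> borel_measurable state_space" "c \<in> borel_measurable state_space"
    and le: "\<And>x. P u x + c x \<le> u x"
  shows "(\<Sum>n. \<integral>\<^sup>+\<omega>. c (X n \<omega>) \<partial>M) \<le> u (0, 1)"
proof -
  note P_measurable[measurable]
  have step: "(\<integral>\<^sup>+\<omega>. u (X (Suc n) \<omega>) \<partial>M) + (\<integral>\<^sup>+\<omega>. c (X n \<omega>) \<partial>M) \<le> (\<integral>\<^sup>+\<omega>. u (X n \<omega>) \<partial>M)" for n
  proof -
    have "(\<integral>\<^sup>+\<omega>. u (X (Suc n) \<omega>) \<partial>M) = (\<integral>\<^sup>+\<omega>. P u (X n \<omega>) \<partial>M)"
      using markov_property[of 0 n u 0] by (simp add: avoids_def cong: nn_integral_cong)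
    then have "(\<integral>\<^sup>+\<omega>. u (X (Suc n) \<omega>) \<partial>M) + (\<integral>\<^sup>+\<omega>. c (X n \<omega>) \<partial>M) = (\<integral>\<^sup>+\<omega>. P u (X n \<omega>) + c (X n \<omega>) \<partial>M)"
      by (simp add: nn_integral_add)
    also have "\<dots> \<le> (\<integral>\<^sup>+\<omega>. u (X n \<omega>) \<partial>M)"
      by (intro nn_integral_mono le)
    finally show ?thesis .
  qed
  have total: "(\<Sum>i<n. \<integral>\<^sup>+\<omega>. c (X i \<omega>) \<partial>M) + (\<integral>\<^sup>+\<omega>. u (X n \<omega>) \<partial>M) \<le> u (0, 1)" for n
  proof (induction n)
    case 0
    show ?case by (simp add: X_def emeasure_space_1)
  next
    case (Suc n)
    have "(\<Sum>i<Suc n. \<integral>\<^sup>+\<omega>. c (X i \<omega>) \<partial>M) + (\<integral>\<^sup>+\<omega>. u (X (Suc n) \<omega>) \<partial>M)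
      = (\<Sum>i<n. \<integral>\<^sup>+\<omega>. c (X i \<omega>) \<partial>M) + ((\<integral>\<^sup>+\<omega>. u (X (Suc n) \<omega>) \<partial>M) + (\<integral>\<^sup>+\<omega>. c (X n \<omega>) \<partial>M))"
      by (simp add: add_ac)
    also have "\<dots> \<le> (\<Sum>i<n. \<integral>\<^sup>+\<omega>. c (X i \<omega>) \<partial>M) + (\<integral>\<^sup>+\<omega>. u (X n \<omega>) \<partial>M)"
      by (intro add_left_mono step)
    finally show ?case using Suc.IH by order
  qed
  have "(\<Sum>i<n. \<integral>\<^sup>+\<omega>. c (X i \<omega>) \<partial>M) \<le> u (0, 1)" for n
    by (rule order_trans[OF _ total[of n]]) (simp add: add_increasing2)
  then show ?thesis by (intro suminf_le_const summableI)
qed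

text \<open>\<open>U UNIV\<close> satisfies the drift condition with cost 1 in state 0. The visit
  probabilities are therefore summable, and Borel-Cantelli applies.\<close>

lemma finite_visits:
  assumes "U UNIV (0, 1) < \<infinity>"
  shows "AE \<omega> in M. finite {n. snd (X n \<omega>) = 0}"
proof -
  define c :: "real \<times> nat \<Rightarrow> ennreal" where "c = (\<lambda>(t, k). if k = 0 then 1 else 0)"
  have Um: "U UNIV \<in> borel_measurable state_space" by (intro measurable_state_space U_measurable) simp
  have "(\<Sum>n. \<integral>\<^sup>+\<omega>. c (X n \<omega>) \<partial>M) \<le> U UNIV (0, 1)"
    by (intro drift Um measurable_state_space) (auto simp: c_def U_UNIV_first_jump)
  also have "(\<lambda>n. \<integral>\<^sup>+\<omega>. c (X n \<omega>) \<partial>M) = (\<lambda>n. emeasure M {\<omega>\<in>space M. snd (X n \<omega>) = 0})"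
  proof
    fix n
    have "(\<integral>\<^sup>+\<omega>. c (X n \<omega>) \<partial>M) = (\<integral>\<^sup>+\<omega>. indicator {\<omega>\<in>space M. snd (X n \<omega>) = 0} \<omega> \<partial>M)"
      by (intro nn_integral_cong) (auto simp: c_def split_beta split: split_indicator)
    then show "(\<integral>\<^sup>+\<omega>. c (X n \<omega>) \<partial>M) = emeasure M {\<omega>\<in>space M. snd (X n \<omega>) = 0}" by simp
  qed
  finally have "(\<Sum>n. emeasure M {\<omega>\<in>space M. snd (X n \<omega>) = 0}) < \<infinity>" using assms by order
  then have "summable (\<lambda>n. measure M {\<omega>\<in>space M. snd (X n \<omega>) = 0})"
    by (intro summable_suminf_not_top) (auto simp: emeasure_eq_measure)
  then have "AE \<omega> in M. \<forall>\<^sub>F n in sequentially. \<omega> \<in> space M - {\<omega>\<in>space M. snd (X n \<omega>) = 0}"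
    by (intro borel_cantelli_AE1) (auto simp: less_top[symmetric])
  then show ?thesis
  proof eventually_elim
    case (elim \<omega>)
    then obtain m where m: "\<And>n. m \<le> n \<Longrightarrow> \<omega> \<in> space M - {\<omega>\<in>space M. snd (X n \<omega>) = 0}"
      by (auto simp: eventually_sequentially)
    have "n < m" if "snd (X n \<omega>) = 0" for n
      by (rule ccontr) (use that m[of n] in auto)
    then have "{n. snd (X n \<omega>) = 0} \<subseteq> {..<m}" by auto
    then show ?case by (rule finite_subset) simp
  qed
qed

text \<open>The drift condition for \<open>N R\<close> makes these probabilities summable, so they
  tend to 0.\<close>

lemma no_explosion: "(\<lambda>n. emeasure M {\<omega>\<in>space M. fst (X n \<omega>) \<le> R}) \<longlonglongrightarrow> 0"
proof -
  define c :: "real \<times> nat \<Rightarrow> ennreal" where "c = (\<lambda>(t, k). indicator {..R} t)"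
  have "(\<Sum>n. \<integral>\<^sup>+\<omega>. c (X n \<omega>) \<partial>M) \<le> N R (0, 1)"
    by (intro drift measurable_state_space N_measurable) (auto simp: c_def N_first_jump)
  also have "(\<lambda>n. \<integral>\<^sup>+\<omega>. c (X n \<omega>) \<partial>M) = (\<lambda>n. emeasure M {\<omega>\<in>space M. fst (X n \<omega>) \<le> R})"
  proof
    fix n
    have "(\<integral>\<^sup>+\<omega>. c (X n \<omega>) \<partial>M) = (\<integral>\<^sup>+\<omega>. indicator {\<omega>\<in>space M. fst (X n \<omega>) \<le> R} \<omega> \<partial>M)"
      by (intro nn_integral_cong) (auto simp: c_def split_beta split: split_indicator)
    then show "(\<integral>\<^sup>+\<omega>. c (X n \<omega>) \<partial>M) = emeasure M {\<omega>\<in>space M. fst (X n \<omega>) \<le> R}" by simp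
  qed
  also have "N R (0, 1) < \<infinity>" by (auto simp: N_def ennreal_mult_less_top split: split_indicator)
  finally have "summable (\<lambda>n. measure M {\<omega>\<in>space M. fst (X n \<omega>) \<le> R})"
    by (intro summable_suminf_not_top) (auto simp: emeasure_eq_measure)
  from tendsto_ennrealI[OF summable_LIMSEQ_zero[OF this]] show ?thesis
    by (simp add: emeasure_eq_measure)
qed

text \<open>Optional stopping at the first visit to 0 from step \<open>n\<close> on:
  \<open>U {..R}\<close> is harmonic off 0 and bounded by \<open>U_zero_le\<close> at 0. The event
  on the right says that 0 is avoided from \<open>l\<close> until \<open>n\<close> but visited
  later.\<close>

lemma visit_zero_bound:
  assumes "l \<le> n"
  shows "(\<integral>\<^sup>+\<omega>\<in>avoids l n. U {..R} (X n \<omega>) \<partial>M) \<le>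
    (6 + ennreal (exp 1) * U {..R} (0, 0)) * emeasure M (avoids l n - (\<Inter>m. avoids l m))"
proof -
  define S where "S = 6 + ennreal (exp 1) * U {..R} (0, 0)"
  have [measurable]: "U {..R} \<in> borel_measurable state_space" by (intro measurable_state_space U_measurable) simp
  have "(\<integral>\<^sup>+\<omega>\<in>avoids l n. U {..R} (X n \<omega>) \<partial>M) \<le>
    S * emeasure M (avoids l n - avoids l (n + j)) + (\<integral>\<^sup>+\<omega>\<in>avoids l (n + j). U {..R} (X (n + j) \<omega>) \<partial>M)" for j
  proof (induction j)
    case (Suc j)
    define m where "m = n + j"
    have lm: "l \<le> m" "n \<le> m" using assms by (auto simp: m_def)
    \<comment> \<open>On \<open>Z\<close> the first visit to 0 since step \<open>l\<close> happens
      exactly at step \<open>m\<close>.\<close>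
    define Z where "Z = {\<omega>\<in>avoids l m. snd (X m \<omega>) = 0}"
    have [measurable]: "Z \<in> sets M" unfolding Z_def by measurable
    have sub: "avoids l (Suc m) = avoids l m - Z"
      using lm by (auto simp: avoids_def Z_def atLeastLessThanSuc)
    have "(\<integral>\<^sup>+\<omega>\<in>avoids l m. U {..R} (X m \<omega>) \<partial>M) \<le>
      (\<integral>\<^sup>+\<omega>. S * indicator Z \<omega> + U {..R} (X m \<omega>) * indicator (avoids l (Suc m)) \<omega> \<partial>M)"
    proof (rule nn_integral_mono_AE, use AE_E_pos in eventually_elim)
      case (elim \<omega>)
      have "U {..R} (X m \<omega>) \<le> S" if "\<omega> \<in> Z"
        using U_zero_le[of "fst (X m \<omega>)" R] X_nonneg[of \<omega> m] elim that
        by (cases "X m \<omega>") (auto simp: Z_def S_def)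
      then show ?case unfolding sub by (auto split: split_indicator simp: Z_def)
    qed
    also have "\<dots> = S * emeasure M Z + (\<integral>\<^sup>+\<omega>\<in>avoids l (Suc m). U {..R} (X m \<omega>) \<partial>M)"
      by (simp add: nn_integral_add nn_integral_cmult_indicator)
    also have "(\<integral>\<^sup>+\<omega>\<in>avoids l (Suc m). U {..R} (X m \<omega>) \<partial>M) = (\<integral>\<^sup>+\<omega>\<in>avoids l (Suc m). P (U {..R}) (X m \<omega>) \<partial>M)"
    proof (rule nn_integral_cong)
      fix \<omega>
      show "U {..R} (X m \<omega>) * indicator (avoids l (Suc m)) \<omega> = P (U {..R}) (X m \<omega>) * indicator (avoids l (Suc m)) \<omega>"
        using lm U_Suc_first_jump[of "{..R}"]
        by (cases "X m \<omega>") (auto simp: avoids_def atLeastLessThanSuc split: split_indicator)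
    qed
    also have "\<dots> = (\<integral>\<^sup>+\<omega>\<in>avoids l (Suc m). U {..R} (X (Suc m) \<omega>) \<partial>M)"
      by (rule markov_property[symmetric]) auto
    finally have "(\<integral>\<^sup>+\<omega>\<in>avoids l n. U {..R} (X n \<omega>) \<partial>M) \<le>
      S * emeasure M (avoids l n - avoids l m) + (S * emeasure M Z + (\<integral>\<^sup>+\<omega>\<in>avoids l (Suc m). U {..R} (X (Suc m) \<omega>) \<partial>M))"
      using Suc.IH unfolding m_def[symmetric] by (meson add_left_mono order_trans)
    also have "\<dots> = S * emeasure M ((avoids l n - avoids l m) \<union> Z) + (\<integral>\<^sup>+\<omega>\<in>avoids l (Suc m). U {..R} (X (Suc m) \<omega>) \<partial>M)"
      by (subst plus_emeasure[symmetric]) (auto simp: Z_def distrib_left add.assoc)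
    also have "(avoids l n - avoids l m) \<union> Z = avoids l n - avoids l (Suc m)"
      using lm by (auto simp: avoids_def Z_def atLeastLessThanSuc)
    finally show ?case by (simp add: m_def)
  qed simp
  moreover have "S * emeasure M (avoids l n - avoids l (n + j)) \<le> S * emeasure M (avoids l n - (\<Inter>m. avoids l m))" for j
    by (intro mult_left_mono emeasure_mono) auto
  \<comment> \<open>What is left on paths not yet stopped is bounded by a constant times the
    probability that jump \<open>n + j\<close> occurs by time \<open>R\<close>.\<close>
  moreover have "(\<integral>\<^sup>+\<omega>\<in>avoids l (n + j). U {..R} (X (n + j) \<omega>) \<partial>M) \<le>
      ennreal (f R * \<bar>R\<bar>) * emeasure M {\<omega>\<in>space M. fst (X (j + n) \<omega>) \<le> R}" for j
  proof -
    have "(\<integral>\<^sup>+\<omega>\<in>avoids l (n + j). U {..R} (X (n + j) \<omega>) \<partial>M) \<le>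
      (\<integral>\<^sup>+\<omega>. ennreal (f R * \<bar>R\<bar>) * indicator {\<omega>\<in>space M. fst (X (j + n) \<omega>) \<le> R} \<omega> \<partial>M)"
    proof (rule nn_integral_mono_AE, use AE_E_pos AE_space in eventually_elim)
      case (elim \<omega>)
      have "U {..R} (X (n + j) \<omega>) \<le> ennreal (f R * \<bar>R\<bar>) * indicator {..R} (fst (X (n + j) \<omega>))"
        using U_bounded[of "fst (X (n + j) \<omega>)" R] X_nonneg[of \<omega> "n + j"] elim by (cases "X (n + j) \<omega>") auto
      then show ?case using elim by (auto split: split_indicator simp: add.commute split: if_splits)
    qed
    then show ?thesis by (simp add: nn_integral_cmult_indicator)
  qed
  ultimately have "(\<integral>\<^sup>+\<omega>\<in>avoids l n. U {..R} (X n \<omega>) \<partial>M) \<le> S * emeasure M (avoids l n - (\<Inter>m. avoids l m)) +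
     ennreal (f R * \<bar>R\<bar>) * emeasure M {\<omega>\<in>space M. fst (X (j + n) \<omega>) \<le> R}" for j
    by (meson add_mono order_trans)
  moreover have "(\<lambda>j. S * emeasure M (avoids l n - (\<Inter>m. avoids l m)) +
     ennreal (f R * \<bar>R\<bar>) * emeasure M {\<omega>\<in>space M. fst (X (j + n) \<omega>) \<le> R})
      \<longlonglongrightarrow> S * emeasure M (avoids l n - (\<Inter>m. avoids l m)) + ennreal (f R * \<bar>R\<bar>) * 0"
    by (intro tendsto_add tendsto_const ennreal_tendsto_cmult LIMSEQ_ignore_initial_segment no_explosion) simp
  ultimately show ?thesis unfolding S_def[symmetric]
    by (intro LIMSEQ_le_const[where X="\<lambda>j. S * emeasure M (avoids l n - (\<Inter>m. avoids l m)) +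
     ennreal (f R * \<bar>R\<bar>) * emeasure M {\<omega>\<in>space M. fst (X (j + n) \<omega>) \<le> R}"]) auto
qed

text \<open>At each step a later visit to 0 has at least a fixed share of the remaining probability.
  Letting the step tend to infinity leaves no mass on paths that avoid 0 forever from
  \<open>l\<close> on.\<close>

lemma infinite_visits:
  assumes div: "(\<integral>\<^sup>+x\<in>{0..}. ennreal (exp (- f x) * f x) \<partial>lborel) = \<infinity>"
  shows "AE \<omega> in M. infinite {n. snd (X n \<omega>) = 0}"
proof -
  have "AE \<omega> in M. \<exists>i\<ge>l. snd (X i \<omega>) = 0" for l
  proof -
    define Z where "Z = (\<Inter>m. avoids l m)"
    have [measurable]: "Z \<in> sets M" unfolding Z_def by measurable
    have le: "emeasure M (avoids l n) \<le> 16 * emeasure M (avoids l n - Z)" if n: "l \<le> n" for n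
    proof -
      define S where "S r = 6 + ennreal (exp 1) * U {..real r} (0, 0)" for r :: nat
      have S: "S r \<noteq> 0" "S r < top" for r
        using U_finite[of 0 "real r" 0] by (auto simp: S_def ennreal_mult_less_top)
      \<comment> \<open>How large \<open>r\<close> must be depends on the random state
        \<open>X n\<close>; \<open>C r\<close> collects the paths for which \<open>r\<close> is
        large enough.\<close>
      define C where "C r = {\<omega>\<in>avoids l n. S r \<le> 16 * U {..real r} (X n \<omega>)}" for r
      have [measurable]: "U {..real r} \<in> borel_measurable state_space" for r by (intro measurable_state_space U_measurable) simp
      have [measurable]: "C r \<in> sets M" for r unfolding C_def by measurable
      have C: "emeasure M (C r) \<le> 16 * emeasure M (avoids l n - Z)" for r
      proof -
        \<comment> \<open>Markov's inequality, followed by \<open>visit_zero_bound\<close>; the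
          finite nonzero factor \<open>S r\<close> then cancels.\<close>
        have "S r * emeasure M (C r) = (\<integral>\<^sup>+\<omega>. S r * indicator (C r) \<omega> \<partial>M)"
          by (simp add: nn_integral_cmult_indicator)
        also have "\<dots> \<le> (\<integral>\<^sup>+\<omega>. 16 * (U {..real r} (X n \<omega>) * indicator (avoids l n) \<omega>) \<partial>M)"
          by (intro nn_integral_mono) (auto simp: C_def split: split_indicator)
        also have "\<dots> = 16 * (\<integral>\<^sup>+\<omega>\<in>avoids l n. U {..real r} (X n \<omega>) \<partial>M)"
          by (rule nn_integral_cmult) measurable
        also have "\<dots> \<le> 16 * (S r * emeasure M (avoids l n - Z))"
          unfolding S_def Z_def by (intro mult_left_mono visit_zero_bound n) simp
        finally have "S r * emeasure M (C r) \<le> S r * (16 * emeasure M (avoids l n - Z))"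
          by (simp add: mult_ac)
        then show ?thesis using S[of r] by (simp add: ennreal_mult_le_mult_iff)
      qed
      have "emeasure M (avoids l n) = (\<integral>\<^sup>+\<omega>. indicator (avoids l n) \<omega> \<partial>M)" by simp
      \<comment> \<open>Almost every path in \<open>avoids l n\<close> lies in \<open>C r\<close>
        for all large \<open>r\<close>, so Fatou's lemma transfers the bound.\<close>
      also have "\<dots> \<le> (\<integral>\<^sup>+\<omega>. liminf (\<lambda>r. indicator (C r) \<omega>) \<partial>M)"
      proof (rule nn_integral_mono_AE, use AE_E_pos in eventually_elim)
        case (elim \<omega>)
        have "\<forall>\<^sub>F r in sequentially. S r \<le> 16 * U {..real r} (X n \<omega>)"
          using eventually_U_large[OF div, of "fst (X n \<omega>)" "snd (X n \<omega>)"] X_nonneg[of \<omega> n] elim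
          by (simp add: S_def)
        then show ?case
          by (intro Liminf_bounded) (auto elim!: eventually_mono simp: C_def split: split_indicator)
      qed
      also have "\<dots> \<le> liminf (\<lambda>r. \<integral>\<^sup>+\<omega>. indicator (C r) \<omega> \<partial>M)"
        by (rule nn_integral_liminf) measurable
      also have "\<dots> = liminf (\<lambda>r. emeasure M (C r))" by simp
      also have "\<dots> \<le> liminf (\<lambda>r::nat. 16 * emeasure M (avoids l n - Z))"
        by (intro Liminf_mono always_eventually allI C)
      also have "\<dots> = 16 * emeasure M (avoids l n - Z)" by (simp add: Liminf_const)
      finally show ?thesis .
    qed
    have sub: "Z \<subseteq> avoids l n" for n by (auto simp: Z_def)
    have le': "prob (avoids l n) \<le> 16 * (prob (avoids l n) - prob Z)" if "l \<le> n" for n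
    proof -
      have "ennreal (prob (avoids l n)) \<le> ennreal (16 * prob (avoids l n - Z))"
        using le[OF that] by (simp add: emeasure_eq_measure ennreal_mult)
      then have "prob (avoids l n) \<le> 16 * prob (avoids l n - Z)"
        by (subst (asm) ennreal_le_iff) auto
      then show ?thesis using finite_measure_Diff[OF _ _ sub[of n]] by simp
    qed
    \<comment> \<open>These events decrease to \<open>Z\<close>, so in the limit the right side of
      \<open>le'\<close> becomes 0.\<close>
    have "(\<lambda>n. prob (avoids l n)) \<longlonglongrightarrow> prob Z"
      unfolding Z_def
      by (rule finite_Lim_measure_decseq) (auto simp: decseq_def avoids_def)
    then have "prob Z \<le> 16 * (prob Z - prob Z)"
      by (intro LIMSEQ_le[of "\<lambda>n. prob (avoids l n)" _ "\<lambda>n. 16 * (prob (avoids l n) - prob Z)"] tendsto_intros)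
        (use le' in auto)
    then have "prob Z = 0" using measure_nonneg[of M Z] by simp
    then have "AE \<omega> in M. \<omega> \<notin> Z"
      by (intro AE_not_in) (simp add: null_sets_def emeasure_eq_measure)
    then show ?thesis
      using AE_space
    proof eventually_elim
      case (elim \<omega>)
      then obtain m where "\<omega> \<notin> avoids l m" by (auto simp: Z_def)
      then show ?case using elim by (auto simp: avoids_def)
    qed
  qed
  then have "AE \<omega> in M. \<forall>l. \<exists>i\<ge>l. snd (X i \<omega>) = 0" by (simp add: AE_all_countable)
  then show ?thesis
    by eventually_elim (simp add: infinite_nat_iff_unbounded_le)
qed

end

section \<open>Measurability of the number of visits\<close>

text \<open>The clocks may be negative on a null set, from where the chain can reach negative times,
  at which \<open>f\<close> is arbitrary. Measurability of the birth time therefore has to be shown without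
  any assumption on \<open>f\<close>.\<close>

lemma tail_integrable_interval:
  fixes f :: "real \<Rightarrow> real" and p :: real
  defines "A \<equiv> {s. s \<le> p \<and> f integrable_on {s..p}}"
  shows "A \<in> sets borel" "(\<lambda>s. indicator A s *\<^sub>R integral {s..p} f) \<in> borel_measurable borel"
proof -
  have up: "s' \<in> A" if "s \<in> A" "s \<le> s'" "s' \<le> p" for s s'
    using that integrable_on_subinterval[of f "{s..p}" s' p] by (auto simp: A_def)
  then have "is_interval A" unfolding is_interval_1 by (auto simp: A_def)
  then show A: "A \<in> sets borel" by (rule real_interval_borel_measurable)
  have "continuous (at s within A) (\<lambda>s. integral {s..p} f)" if s: "s \<in> A" for s
  proof -
    have c: "continuous (at s within {c..p}) (\<lambda>s. integral {s..p} f)" if "c \<in> A" "c \<le> s" for c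
      using indefinite_integral_continuous_1'[of f c p] that s
      by (auto simp: A_def continuous_on_eq_continuous_within)
    show ?thesis
    \<comment> \<open>If \<open>s\<close> is not the least element, \<open>A\<close> agrees near
      \<open>s\<close> with some \<open>{c..p}\<close>; otherwise \<open>A\<close> is
      \<open>{s..p}\<close> itself.\<close>
    proof (cases "\<exists>c\<in>A. c < s")
      case True
      then obtain c where "c \<in> A" "c < s" by blast
      moreover have "at s within A = at s within {c..p}"
        by (rule at_within_nhd[of s "{c<..}"]) (use calculation up in \<open>auto simp: A_def\<close>)
      ultimately show ?thesis using c[of c] by simp
    next
      case False
      then have "A = {s..p}" using s up by (force simp: A_def)
      then show ?thesis using c[of s] s by simp
    qed
  qed
  then have "continuous_on A (\<lambda>s. integral {s..p} f)"
    by (simp add: continuous_on_eq_continuous_within)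
  then show "(\<lambda>s. indicator A s *\<^sub>R integral {s..p} f) \<in> borel_measurable borel"
    by (rule borel_measurable_continuous_on_indicator[OF A])
qed

lemma Collect_in_sets_borel_pair:
  fixes Q :: "real \<times> real \<Rightarrow> bool"
  shows "Measurable.pred (borel \<Otimes>\<^sub>M borel) Q \<Longrightarrow> {p. Q p} \<in> sets (borel \<Otimes>\<^sub>M borel)"
  by (simp add: pred_def space_pair_measure)

text \<open>Splitting the integral at a rational \<open>q\<close> separates \<open>s\<close> from
  \<open>t\<close> and leaves a countable union. A function that is not integrable has integral 0 by
  convention, so \<open>e > 0\<close> forces integrability, while \<open>e \<le> 0\<close> is met by
  \<open>t = s\<close>.\<close>

lemma birth_before_measurable:
  fixes f :: "real \<Rightarrow> real"
  shows "{p. \<exists>t. fst p \<le> t \<and> t < r \<and> snd p \<le> integral {fst p..t} f} \<in> sets (borel \<Otimes>\<^sub>M borel)"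
proof -
  define A where "A q = {s. s \<le> q \<and> f integrable_on {s..q}}" for q
  define J where "J q s = indicator (A q) s *\<^sub>R integral {s..q} f" for q s
  define Y where "Y q = {y. \<exists>t. q \<le> t \<and> t < r \<and> f integrable_on {q..t} \<and> y \<le> integral {q..t} f}" for q
  have [measurable]: "A q \<in> sets borel" "J q \<in> borel_measurable borel" for q
    using tail_integrable_interval[of q f] unfolding A_def J_def by auto
  have "is_interval (Y q)" for q unfolding is_interval_1 Y_def by (blast intro: order_trans)
  then have [measurable]: "Y q \<in> sets borel" for q by (rule real_interval_borel_measurable)
  have "(\<exists>t. s \<le> t \<and> t < r \<and> e \<le> integral {s..t} f) \<longleftrightarrow>
    (e \<le> 0 \<and> s < r) \<or> (\<exists>q\<in>\<rat>. s \<in> A q \<and> e - J q s \<in> Y q)" (is "?L \<longleftrightarrow> ?R") for s e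
  proof
    assume ?L
    then obtain t where t: "s \<le> t" "t < r" "e \<le> integral {s..t} f" by blast
    show ?R
    proof (cases "e \<le> 0")
      case False
      then have int: "f integrable_on {s..t}" using t(3) not_integrable_integral[of f "{s..t}"] by auto
      have "s \<noteq> t" using False t(3) by auto
      then obtain q where q: "q \<in> \<rat>" "s < q" "q < t" using Rats_dense_in_real[of s t] t(1) by auto
      have "f integrable_on {s..q}" "f integrable_on {q..t}"
        using q by (auto intro: integrable_on_subinterval[OF int])
      moreover have "integral {s..q} f + integral {q..t} f = integral {s..t} f"
        using q by (intro Henstock_Kurzweil_Integration.integral_combine int) auto
      ultimately show ?thesis using q t by (force simp: A_def J_def Y_def)
    qed (use t in auto)
  next
    assume ?R
    then show ?L
    proof (elim disjE conjE bexE)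
      fix q assume "s \<in> A q" "e - J q s \<in> Y q"
      then obtain t where t: "s \<le> q" "q \<le> t" "t < r" "f integrable_on {s..q}" "f integrable_on {q..t}"
        "e - integral {s..q} f \<le> integral {q..t} f" by (auto simp: A_def J_def Y_def)
      have "f integrable_on {s..t}"
        using t by (intro Henstock_Kurzweil_Integration.integrable_combine[of s q t]) auto
      then have "integral {s..q} f + integral {q..t} f = integral {s..t} f"
        using t by (intro Henstock_Kurzweil_Integration.integral_combine) auto
      then show ?L using t by (intro exI[of _ t]) auto
    qed (auto intro!: exI[of _ s])
  qed
  then have "{p. \<exists>t. fst p \<le> t \<and> t < r \<and> snd p \<le> integral {fst p..t} f} =
    {p. snd p \<le> 0 \<and> fst p < r} \<union> (\<Union>q\<in>\<rat>. {p. fst p \<in> A q \<and> snd p - J q (fst p) \<in> Y q})"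
    by auto
  also have "\<dots> \<in> sets (borel \<Otimes>\<^sub>M borel)"
  proof (intro sets.Un sets.countable_UN' countable_rat)
    show "{p::real \<times> real. snd p \<le> 0 \<and> fst p < r} \<in> sets (borel \<Otimes>\<^sub>M borel)"
      by (rule Collect_in_sets_borel_pair) measurable
    show "(\<lambda>q. {p. fst p \<in> A q \<and> snd p - J q (fst p) \<in> Y q}) ` \<rat> \<subseteq> sets (borel \<Otimes>\<^sub>M borel)"
      by (intro image_subsetI Collect_in_sets_borel_pair) measurable
  qed
  finally show ?thesis .
qed

text \<open>Real-valued encodings of the birth time and of the state, with \<open>(0, 0)\<close> for \<open>None\<close>.\<close>

definition birth_finite :: "(real \<Rightarrow> real) \<Rightarrow> real \<Rightarrow> real \<Rightarrow> bool" where
  "birth_finite f s e \<longleftrightarrow> (\<exists>t\<ge>s. e \<le> integral {s..t} f)"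

definition birth_real :: "(real \<Rightarrow> real) \<Rightarrow> real \<Rightarrow> real \<Rightarrow> real" where
  "birth_real f s e = (if birth_finite f s e then Inf {t. t \<ge> s \<and> integral {s..t} f \<ge> e} else 0)"

lemma birth_time_eq: "birth_time f s e = (if birth_finite f s e then ereal (birth_real f s e) else \<infinity>)"
  by (simp add: birth_time_def birth_real_def birth_finite_def)

lemma birth_finite_measurable [measurable]: "Measurable.pred (borel \<Otimes>\<^sub>M borel) (\<lambda>p. birth_finite f (fst p) (snd p))"
proof -
  have "{p. birth_finite f (fst p) (snd p)} = (\<Union>n. {p. \<exists>t. fst p \<le> t \<and> t < real n \<and> snd p \<le> integral {fst p..t} f})"
    using reals_Archimedean2 by (fastforce simp: birth_finite_def)
  also have "\<dots> \<in> sets (borel \<Otimes>\<^sub>M borel)" using birth_before_measurable by blast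
  finally show ?thesis by (simp add: pred_def space_pair_measure)
qed

lemma birth_real_measurable [measurable]: "(\<lambda>p. birth_real f (fst p) (snd p)) \<in> borel_measurable (borel \<Otimes>\<^sub>M borel)"
  unfolding borel_measurable_iff_less
proof
  fix r
  have less: "Inf {t. t \<ge> s \<and> integral {s..t} f \<ge> e} < r \<longleftrightarrow> (\<exists>t. s \<le> t \<and> t < r \<and> e \<le> integral {s..t} f)"
    if "birth_finite f s e" for s e
    using that by (subst cInf_less_iff) (auto simp: birth_finite_def)
  \<comment> \<open>The second set comes from the default value 0 of
    \<open>birth_real\<close>.\<close>
  have "{p. birth_real f (fst p) (snd p) < r} =
    {p. \<exists>t. fst p \<le> t \<and> t < r \<and> snd p \<le> integral {fst p..t} f} \<union> {p. \<not> birth_finite f (fst p) (snd p) \<and> 0 < r}"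
    by (auto simp: birth_real_def less) (auto simp: birth_finite_def)
  also have "\<dots> \<in> sets (borel \<Otimes>\<^sub>M borel)"
    by (intro sets.Un birth_before_measurable Collect_in_sets_borel_pair) measurable
  finally show "{p \<in> space (borel \<Otimes>\<^sub>M borel). birth_real f (fst p) (snd p) < r} \<in> sets (borel \<Otimes>\<^sub>M borel)"
    by (simp add: space_pair_measure)
qed

fun enc :: "(real \<times> nat) option \<Rightarrow> real \<times> nat" where
  "enc None = (0, 0)"
| "enc (Some (s, k)) = (s, Suc k)"

text \<open>The encoded state \<open>j\<close> is the true state plus 1: \<open>j = 0\<close> stands
  for \<open>None\<close>, and \<open>j = 1\<close> for state 0, which has no death clock.\<close>

lemma enc_bd_step:
  "enc (bd_step f a b x) = (let s = fst (enc x); j = snd (enc x); d = s + b / real (j - 1) in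
     if j = 0 then (0, 0)
     else if birth_finite f s a \<and> (j = 1 \<or> birth_real f s a < d) then (birth_real f s a, Suc j)
     else if j = 1 then (0, 0) else (d, j - 1))"
  by (cases x) (auto simp: birth_time_eq death_time_def Let_def)

lemma bd_chain_measurable:
  assumes [measurable]: "\<And>n b. E n b \<in> borel_measurable M"
  shows "(\<lambda>\<omega>. enc (bd_chain f E n \<omega>)) \<in> M \<rightarrow>\<^sub>M borel \<Otimes>\<^sub>M count_space UNIV"
proof (induction n)
  case (Suc n)
  note Suc[measurable]
  have [measurable]: "Measurable.pred M (\<lambda>\<omega>. birth_finite f (fst (enc (bd_chain f E n \<omega>))) (E n True \<omega>))"
    using measurable_compose[OF _ birth_finite_measurable, of "\<lambda>\<omega>. (fst (enc (bd_chain f E n \<omega>)), E n True \<omega>)" M f] by simp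
  have [measurable]: "(\<lambda>\<omega>. birth_real f (fst (enc (bd_chain f E n \<omega>))) (E n True \<omega>)) \<in> borel_measurable M"
    using measurable_compose[OF _ birth_real_measurable, of "\<lambda>\<omega>. (fst (enc (bd_chain f E n \<omega>)), E n True \<omega>)" M f] by simp
  show ?case unfolding bd_chain.simps enc_bd_step Let_def by measurable
qed simp

lemma infinite_up_from_zero_measurable:
  assumes "\<And>n b. E n b \<in> borel_measurable M"
  shows "{\<omega> \<in> space M. infinite (up_from_zero f E \<omega>)} \<in> sets M"
proof -
  note bd_chain_measurable[OF assms, measurable]
  have 1: "(\<exists>s. x = Some (s, k)) \<longleftrightarrow> snd (enc x) = Suc k" for x k by (cases x) auto
  \<comment> \<open>By the shift in \<open>enc\<close>, the values \<open>Suc 0\<close> and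
    \<open>Suc 1\<close> stand for the states 0 and 1.\<close>
  have "infinite (up_from_zero f E \<omega>) \<longleftrightarrow> (\<forall>m. \<exists>n. m \<le> n \<and> snd (enc (bd_chain f E n \<omega>)) = Suc 0
     \<and> snd (enc (bd_chain f E (Suc n) \<omega>)) = Suc 1)" for \<omega>
    unfolding infinite_nat_iff_unbounded_le up_from_zero_def by (simp add: 1 del: bd_chain.simps)
  then show ?thesis by (simp del: bd_chain.simps)
qed

section \<open>Comparison with the given chain\<close>

lemma up_from_zero_empty:
  assumes f: "\<And>t. 0 \<le> t \<Longrightarrow> f t = 0" and E: "\<And>n b. 0 < E n b \<omega>"
  shows "up_from_zero f E \<omega> = {}"
proof -
  \<comment> \<open>From a nonnegative time the accumulated rate stays 0 and never reaches a
    positive clock value.\<close>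
  have b: "birth_time f s (E n b \<omega>) = \<infinity>" if "0 \<le> s" for s n b
  proof -
    have "integral {s..t} f = 0" for t
      using that f integral_cong[of "{s..t}" f "\<lambda>_. 0"] by auto
    then show ?thesis using E[of n b] by (auto simp: birth_time_def not_le)
  qed
  have nonneg: "0 \<le> s" if "bd_chain f E n \<omega> = Some (s, k)" for n s k
    using that
  proof (induction n arbitrary: s k)
    case (Suc n)
    then obtain r j where r: "bd_chain f E n \<omega> = Some (r, j)"
      by (cases "bd_chain f E n \<omega>") auto
    then have "0 \<le> r" by (rule Suc.IH)
    then show ?case
      using Suc.prems r b[of r n True] E[of n False]
      by (auto simp: death_time_def Let_def split: if_splits)
  qed simp
  show ?thesis
    using nonneg b by (fastforce simp: up_from_zero_def Let_def death_time_def)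
qed

text \<open>With positive clocks all jump times are nonnegative, and there \<open>f t\<close> and
  \<open>f (max 0 t)\<close> agree. Every birth time is then finite and equal to \<open>bt\<close>,
  so \<open>None\<close> never occurs.\<close>

lemma bd_chain_eq_X:
  fixes f :: "real \<Rightarrow> real"
  assumes "bd_process (\<lambda>t. f (max 0 t)) M E" and E: "\<And>n b. 0 < E n b \<omega>"
  shows "bd_chain f E n \<omega> = Some (bd_process.X (\<lambda>t. f (max 0 t)) E n \<omega>)"
proof -
  interpret bd_process "\<lambda>t. f (max 0 t)" M E by fact
  have b: "birth_time f s e = ereal (bt s e)" if "0 \<le> s" for s e
  proof -
    have eq: "integral {s..t} f = F t - F s" if "s \<le> t" for t
      unfolding F_diff[OF that] using \<open>0 \<le> s\<close> by (intro integral_cong) (auto simp: max_def)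
    obtain t where "s \<le> t" "e + F s \<le> F t" using F_unbounded by blast
    then have "\<exists>t\<ge>s. e \<le> integral {s..t} f" using eq[of t] by (auto intro!: exI[of _ t])
    moreover have "{t. s \<le> t \<and> e \<le> integral {s..t} f} = {t. s \<le> t \<and> e \<le> F t - F s}"
      using eq by auto
    ultimately show ?thesis by (simp add: birth_time_def bt_def)
  qed
  show ?thesis
  proof (induction n)
    case (Suc n)
    obtain s k where sk: "X n \<omega> = (s, k)" by (cases "X n \<omega>")
    then have "0 \<le> s" using X_nonneg[OF E, of n] by simp
    then show ?case using Suc sk
      by (auto simp: b X_def step_def ev_def death_time_def Let_def)
  qed (simp add: X_def)
qed

text \<open>From state 0 the next jump exists and leads to 1, so upward jumps from 0 and visits to 0
  have the same indices.\<close>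

lemma up_from_zero_eq_visits:
  assumes "bd_process (\<lambda>t. f (max 0 t)) M E" and "\<And>n b. 0 < E n b \<omega>"
  shows "up_from_zero f E \<omega> = {n. snd (bd_process.X (\<lambda>t. f (max 0 t)) E n \<omega>) = 0}"
proof -
  interpret bd_process "\<lambda>t. f (max 0 t)" M E by fact
  have "n \<in> up_from_zero f E \<omega> \<longleftrightarrow> snd (X n \<omega>) = 0" for n
    unfolding up_from_zero_def bd_chain_eq_X[OF assms] mem_Collect_eq
    by (cases "X n \<omega>") (auto simp: X_def step_def)
  then show ?thesis by blast
qed

theorem theorem3:
  fixes f :: "real \<Rightarrow> real" and M :: "'a measure" and E :: "nat \<Rightarrow> bool \<Rightarrow> 'a \<Rightarrow> real"
  assumes "prob_space M"
    and "\<And>t. t \<ge> 0 \<Longrightarrow> f t \<ge> 0"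
    and "mono_on {0..} f"
    and "prob_space.indep_vars M (\<lambda>_. borel) (\<lambda>(n, b). E n b) UNIV"
    and "\<And>n b. distributed M lborel (E n b) (exponential_density 1)"
  shows "(measure M {\<omega> \<in> space M. infinite (up_from_zero f E \<omega>)} = 1 \<longleftrightarrow>
            (\<integral>\<^sup>+ t \<in> {0..}. ennreal (exp (- f t) * f t) \<partial>lborel) = \<infinity>)
       \<and> ((\<integral>\<^sup>+ t \<in> {0..}. ennreal (exp (- f t) * f t) \<partial>lborel) < \<infinity> \<longrightarrow>
            measure M {\<omega> \<in> space M. infinite (up_from_zero f E \<omega>)} = 0)"
proof -
  interpret prob_space M by fact
  define S where "S = {\<omega> \<in> space M. infinite (up_from_zero f E \<omega>)}"
  define I where "I = (\<integral>\<^sup>+ t \<in> {0..}. ennreal (exp (- f t) * f t) \<partial>lborel)"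
  have S: "S \<in> sets M"
    unfolding S_def using distributed_measurable[OF assms(5)]
    by (intro infinite_up_from_zero_measurable) simp
  have E_pos: "AE \<omega> in M. \<forall>n b. 0 < E n b \<omega>"
    using distributed_exponential_AE_pos[OF assms(5)] by (simp add: AE_all_countable)
  \<comment> \<open>This zero-one alternative contains both claims. A rate vanishing on all
    nonnegative times is treated separately, because then the birth clock never rings and the
    integral is 0.\<close>
  have "if I = \<infinity> then AE \<omega> in M. \<omega> \<in> S else AE \<omega> in M. \<omega> \<notin> S"
  proof (cases "\<exists>t\<ge>0. 0 < f t")
    case False
    then have f0: "f t = 0" if "0 \<le> t" for t using assms(2)[OF that] that by force
    have "I = (\<integral>\<^sup>+t. 0 \<partial>(lborel :: real measure))"
      unfolding I_def by (intro nn_integral_cong) (auto simp: f0 split: split_indicator)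
    moreover have "AE \<omega> in M. \<omega> \<notin> S"
      using E_pos by eventually_elim (simp add: S_def up_from_zero_empty f0)
    ultimately show ?thesis by simp
  next
    case True
    \<comment> \<open>Extending the rate by its value at 0 makes it monotone on the whole line and
      leaves the integral unchanged.\<close>
    define f' where "f' t = f (max 0 t)" for t
    have "mono f'" using assms(3) by (auto simp: f'_def mono_on_def intro!: monoI)
    then have bd: "bd_process f' M E"
      using True assms
      by unfold_locales (auto simp: f'_def max_def intro: exI)
    interpret bd: bd_process f' M E by (rule bd)
    have visits: "AE \<omega> in M. up_from_zero f E \<omega> = {n. snd (bd.X n \<omega>) = 0}"
      using E_pos by eventually_elim (use up_from_zero_eq_visits[of f M E] bd in \<open>simp add: f'_def[abs_def]\<close>)
    have I': "I = (\<integral>\<^sup>+t\<in>{0..}. ennreal (exp (- f' t) * f' t) \<partial>lborel)"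
      unfolding I_def by (intro nn_integral_cong) (auto simp: f'_def max_def split: split_indicator)
    show ?thesis
    proof (cases "I = \<infinity>")
      case True
      have "AE \<omega> in M. \<omega> \<in> S"
        using visits bd.infinite_visits[OF I'[symmetric, unfolded True]] AE_space
        by eventually_elim (simp add: S_def)
      then show ?thesis using True by simp
    next
      case False
      then have "bd.U UNIV (0, 1) < \<infinity>"
        using bd.U_UNIV_finite unfolding I'[symmetric] by (simp add: less_top)
      from visits bd.finite_visits[OF this] have "AE \<omega> in M. \<omega> \<notin> S"
        by eventually_elim (simp add: S_def)
      then show ?thesis using False by simp
    qed
  qed
  then show ?thesis
    using prob_eq_1[OF S] prob_eq_0[OF S] unfolding S_def[symmetric] I_def[symmetric]
    by (auto split: if_splits)
qed

end
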